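(* For each integer $n\ge 0$, let $D_n$ be the number of diagonal boxes (cells on the main diagonal) in a symmetric tree--like tableau chosen uniformly at random from the (finite) set of all symmetric tree--like tableaux of size $2n+1$. Then, as $n\to\infty$, \[\frac{D_n-3(n+1)/4}{\sqrt{7(n+1)/48}}\stackrel{d}{\longrightarrow} N(0,1),\] where $\stackrel{d}{\longrightarrow}$ denotes convergence in distribution and $N(0,1)$ denotes a standard normal random variable.
   Context: A Ferrers diagram is a left--aligned finite set of cells arranged in rows and columns with weakly decreasing numbers of cells in rows (from top to bottom). Its half--perimeter is the number of rows plus the number of columns. A tree--like tableau of size $n$ is a Ferrers diagram of half--perimeter $n+1$ in which some cells (called pointed cells) are filled with a point, according to the following rules: (1) the cell in the first column and first row is pointed (this point is called the root point); (2) every row and every column contains at least one pointed cell; (3) for every pointed cell other than the root cell, either all the cells above it in the same column are empty (contain no point), or all the cells to its left in the same row are empty, but not both. A symmetric tree--like tableau is a tree--like tableau which is symmetric about its main diagonal (both the diagram and the set of pointed cells are invariant under the reflection exchanging rows and columns). The size of a symmetric tree--like tableau is always odd. A diagonal box (diagonal cell) is a cell of the diagram, pointed or not, lying in row $i$ and column $i$ for some $i$. Known fact: if $B(n,k)$ is the number of symmetric tree--like tableaux of size $2n+1$ with exactly $k$ diagonal cells, then the generating polynomials $B_n(x)=\sum_{k=1}^{n+1}B(n,k)x^k$ satisfy $B_0(x)=x$ and $B_n(x)=nx(x+1)B_{n-1}(x)+x(1-x^2)B_{n-1}'(x)$ for $n\ge1$. Thus $\mathbb{P}(D_n=k)=B(n,k)/B_n(1)$.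 *)

theory Defs
  imports "HOL-Probability.Probability"
begin

text \<open>
  A cell is a pair (row, column), both counted from 0 at the top left corner; a diagram is a set
  of cells. So \<^term>\<open>Domain D\<close> and \<^term>\<open>Range D\<close> are the indices of the (nonempty) rows and columns
  of \<^term>\<open>D\<close>, and the reflection in the main diagonal is the relational converse.
\<close>

definition ferrers_diagram :: "(nat \<times> nat) set \<Rightarrow> bool" where
  "ferrers_diagram D \<longleftrightarrow>
     finite D \<and>
     (\<forall>i j j'. (i, j) \<in> D \<and> j' < j \<longrightarrow> (i, j') \<in> D) \<and>
     (\<forall>i i'. i \<le> i' \<longrightarrow> card {j. (i', j) \<in> D} \<le> card {j. (i, j) \<in> D})"

definition half_perimeter :: "(nat \<times> nat) set \<Rightarrow> nat" where
  "half_perimeter D = card (Domain D) + card (Range D)"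

text \<open>A tableau is a pair of a diagram and its set of pointed cells.\<close>

type_synonym tableau = "(nat \<times> nat) set \<times> (nat \<times> nat) set"

definition tree_like_tableau :: "nat \<Rightarrow> tableau \<Rightarrow> bool" where
  "tree_like_tableau n = (\<lambda>(D, P).
     ferrers_diagram D \<and> half_perimeter D = n + 1 \<and> P \<subseteq> D \<and>
     (0, 0) \<in> P \<and>
     (\<forall>i \<in> Domain D. \<exists>j. (i, j) \<in> P) \<and>
     (\<forall>j \<in> Range D. \<exists>i. (i, j) \<in> P) \<and>
     (\<forall>i j. (i, j) \<in> P \<and> (i, j) \<noteq> (0, 0) \<longrightarrow>
        ((\<forall>i'<i. (i', j) \<notin> P) \<or> (\<forall>j'<j. (i, j') \<notin> P)) \<and>
        \<not> ((\<forall>i'<i. (i', j) \<notin> P) \<and> (\<forall>j'<j. (i, j') \<notin> P))))"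

definition symmetric_tree_like_tableaux :: "nat \<Rightarrow> tableau set" where
  "symmetric_tree_like_tableaux n =
     {(D, P). tree_like_tableau n (D, P) \<and> D\<inverse> = D \<and> P\<inverse> = P}"

definition diagonal_boxes :: "tableau \<Rightarrow> nat" where
  "diagonal_boxes T = card {c \<in> fst T. fst c = snd c}"

lemma ferrers_diagram_left:
  assumes D: "ferrers_diagram D" and c: "(i, j) \<in> D" and "j' \<le> j"
  shows "(i, j') \<in> D"
proof (cases "j' = j")
  case False
  with \<open>j' \<le> j\<close> have "j' < j" by simp
  with D c show ?thesis unfolding ferrers_diagram_def by blast
qed (use c in simp)

lemma ferrers_diagram_up:
  assumes D: "ferrers_diagram D" and c: "(i, j) \<in> D" and "i' \<le> i"
  shows "(i', j) \<in> D"
proof (rule ccontr)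
  assume n: "(i', j) \<notin> D"
  have fin: "finite {j. (k, j) \<in> D}" for k
  proof -
    have "finite D" using D by (simp add: ferrers_diagram_def)
    then have "finite (Range D)" by (rule finite_Range)
    then show ?thesis by (rule finite_subset[rotated]) auto
  qed
  note left = ferrers_diagram_left[OF D]
  have "{b. (i', b) \<in> D} \<subseteq> {..<j}"
  proof
    fix b assume "b \<in> {b. (i', b) \<in> D}"
    then show "b \<in> {..<j}" using n left[of i' b j] by (cases "b < j") auto
  qed
  from card_mono[OF _ this] have "card {b. (i', b) \<in> D} \<le> j" by simp
  moreover have "{..j} \<subseteq> {b. (i, b) \<in> D}" using left c by auto
  from card_mono[OF fin this] have "Suc j \<le> card {b. (i, b) \<in> D}" by simp
  moreover have "card {b. (i, b) \<in> D} \<le> card {b. (i', b) \<in> D}"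
    using D \<open>i' \<le> i\<close> unfolding ferrers_diagram_def by blast
  ultimately show False by linarith
qed

text \<open>
  The next two facts make \<^term>\<open>pmf_of_set (symmetric_tree_like_tableaux (2 * n + 1))\<close>
  the uniform distribution: \<^const>\<open>pmf_of_set\<close> is unspecified on empty and infinite sets.
\<close>

lemma finite_symmetric_tree_like_tableaux: "finite (symmetric_tree_like_tableaux n)"
proof (rule finite_subset)
  let ?B = "{..n} \<times> {..n}"
  show "finite (Pow ?B \<times> Pow ?B)" by simp
  have sub: "D \<subseteq> ?B" if "ferrers_diagram D" "half_perimeter D = n + 1" for D
  proof clarify
    fix i j assume c: "(i, j) \<in> D"
    have f: "finite D" using that(1) by (simp add: ferrers_diagram_def)
    have "{..i} \<subseteq> Domain D" using ferrers_diagram_up[OF that(1) c] by auto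
    from card_mono[OF finite_Domain[OF f] this] have 1: "Suc i \<le> card (Domain D)" by simp
    have "{..j} \<subseteq> Range D" using ferrers_diagram_left[OF that(1) c] by auto
    from card_mono[OF finite_Range[OF f] this] have 2: "Suc j \<le> card (Range D)" by simp
    from 1 2 that(2) show "i \<in> {..n} \<and> j \<in> {..n}"
      by (auto simp: half_perimeter_def)
  qed
  show "symmetric_tree_like_tableaux n \<subseteq> Pow ?B \<times> Pow ?B"
  proof
    fix T assume T: "T \<in> symmetric_tree_like_tableaux n"
    obtain D P where DP: "T = (D, P)" by (cases T)
    from T have "ferrers_diagram D" "half_perimeter D = n + 1" "P \<subseteq> D"
      by (simp_all add: DP symmetric_tree_like_tableaux_def tree_like_tableau_def)
    with sub[of D] show "T \<in> Pow ?B \<times> Pow ?B" unfolding DP by blast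
  qed
qed

lemma symmetric_tree_like_tableaux_nonempty: "symmetric_tree_like_tableaux (2 * n + 1) \<noteq> {}"
proof -
  define D :: "(nat \<times> nat) set" where "D = {0} \<times> {..n} \<union> {..n} \<times> {0}"
  have dr: "Domain D = {..n}" "Range D = {..n}" by (auto simp: D_def)
  have row: "{j. (i, j) \<in> D} = (if i = 0 then {..n} else if i \<le> n then {0} else {})" for i
    by (auto simp: D_def)
  have "ferrers_diagram D"
    unfolding ferrers_diagram_def row by (auto simp: D_def)
  then have "(D, D) \<in> symmetric_tree_like_tableaux (2 * n + 1)"
    unfolding symmetric_tree_like_tableaux_def tree_like_tableau_def half_perimeter_def
    by (auto simp: dr) (auto simp: D_def)
  then show ?thesis by auto
qed

end

theory Submission
  imports Defs "HOL-Computational_Algebra.Polynomial" "HOL-Real_Asymp.Real_Asymp"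
begin

text \<open>
  A symmetric tableau is determined by its upper half: the cells weakly above the diagonal and the
  points strictly above it. Say that a point of the half is covered if its column contains a point
  above it. For an index i > 0, read column i of the half from top to bottom and then row i from
  left to right; in the full tableau this hook is row i. The tableau axioms say that a point of
  row i is covered exactly if it is the first point of its hook. So a row has at most one covered
  point, this point is the leftmost one of the row, and column i is empty exactly if row i has a
  covered point (\<open>fold_tableau_in_half_tableaux\<close>, \<open>unfold_tableau_symmetric\<close>).

  Cut the columns of the half off from right to left, and call a row open as long as none of its
  covered points has been cut off. A column whose index is an open row carries points in a nonempty
  set of open rows, and each of these rows except the topmost one ceases to be open; a column whose
  index is not an open row is empty. The number of ways to continue therefore depends on the open
  rows only through their number, and the generating polynomial of the number of diagonal boxes
  satisfies a recurrence in the number of remaining border steps and the number of open rows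
  (\<open>diag_poly_half_tableaux\<close>). Expanding it in numbers of ordered set partitions makes the
  recurrence tridiagonal, and the tridiagonal recurrence implies a first-order differential
  recurrence (\<open>block_poly_differential\<close>), whose instance for a single open row is
  \<open>diagonal_poly_Suc\<close>.

  In terms of coefficients, this says that the number of diagonal boxes is a Markov chain: with
  m = n + 1, a value k at time n increases by 0, 1 or 2 with probabilities k / 2m, 1 / 2 and
  (m - k) / 2m (\<open>average_Suc\<close>). Let Y be the deviation of the chain from 3(n + 1)/4. Then n Y is a
  martingale whose increment at time m has the conditional variance 7 m^2 / 16 up to a term of order
  m |Y|, and |Y| is of order sqrt m in the mean. So, up to a negligible error, each step multiplies
  the characteristic function of n Y at s by exp (- 7 s^2 m^2 / 32) (\<open>scaled_char_step\<close>). Since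
  the sum of m^2 for m up to n is asymptotically n^3 / 3, the deviation has the asymptotic variance
  7 n / 48, and Levy's continuity theorem gives the limit law.
\<close>

section \<open>Ordered set partitions and the recurrence for the diagonal polynomials\<close>

text \<open>
  The number of surjections from an m-set onto a j-set, that is, of ordered set partitions of an
  m-set into j blocks: the last element either joins one of j blocks or is a block of its own.
\<close>

fun surjections :: "nat \<Rightarrow> nat \<Rightarrow> nat" where
  "surjections 0 j = (if j = 0 then 1 else 0)"
| "surjections (Suc m) j = j * (surjections m j + surjections m (j - 1))"

lemma surjections_eq_0: "m < j \<Longrightarrow> surjections m j = 0"
  by (induction m arbitrary: j) auto

text \<open>
  Map every subset of size i onto j blocks; the complement of the subset is block number j + 1, which
  is either nonempty or empty.
\<close>

lemma sum_choose_surjections_atMost: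
  "(\<Sum>i\<le>k. (k choose i) * surjections i j) = surjections k (Suc j) + surjections k j"
proof (induction k arbitrary: j)
  case 0
  then show ?case by simp
next
  case (Suc k)
  let ?U = "\<lambda>j. \<Sum>i\<le>k. (k choose i) * surjections i j"
  have "(\<Sum>i\<le>Suc k. (Suc k choose i) * surjections i j)
      = surjections 0 j + (\<Sum>i\<le>k. (Suc k choose Suc i) * surjections (Suc i) j)"
    by (subst sum.atMost_Suc_shift) simp
  also have "\<dots> = (surjections 0 j + (\<Sum>i\<le>k. (k choose Suc i) * surjections (Suc i) j))
      + (\<Sum>i\<le>k. (k choose i) * surjections (Suc i) j)"
    by (simp add: sum.distrib algebra_simps)
  also have "surjections 0 j + (\<Sum>i\<le>k. (k choose Suc i) * surjections (Suc i) j)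
      = (\<Sum>i\<le>Suc k. (k choose i) * surjections i j)"
    by (subst sum.atMost_Suc_shift) simp
  also have "\<dots> = ?U j" by (simp add: binomial_eq_0)
  also have "(\<Sum>i\<le>k. (k choose i) * surjections (Suc i) j) = j * (?U j + ?U (j - 1))"
    by (simp add: sum.distrib sum_distrib_left algebra_simps)
  finally show ?case by (cases j) (simp_all add: Suc.IH algebra_simps)
qed

lemma sum_choose_surjections:
  "(\<Sum>i<k. (k choose i) * surjections i j) = surjections k (Suc j)"
proof -
  have "(\<Sum>i\<le>k. (k choose i) * surjections i j)
      = (\<Sum>i<k. (k choose i) * surjections i j) + surjections k j"
    by (simp flip: lessThan_Suc_atMost)
  then show ?thesis using sum_choose_surjections_atMost[of k j] by simp
qed

abbreviation X :: "real poly" where "X \<equiv> [:0, 1:]"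

text \<open>
  These polynomials are the coordinates of the counting polynomials in the basis of numbers of
  ordered set partitions, see \<open>completion_poly\<close> below. The recurrence expresses the
  map g(y) \<mapsto> (X - 1) y g(y) + (y + 1) g(y + 1), which describes one border step, in the basis of the
  binomial polynomials (y choose j).
\<close>

fun block_poly :: "nat \<Rightarrow> nat \<Rightarrow> real poly" where
  "block_poly 0 j = 1"
| "block_poly (Suc n) j = X * of_nat (Suc j) * block_poly n (Suc j)
    + ((X + 1) * of_nat j + 1) * block_poly n j
     + of_nat j * block_poly n (j - 1)"

text \<open>
  Let M be the operator of the tridiagonal recurrence and L f = K f + X (1 - X) f', where
  (K f) j = j f (j - 1) + (j + 1) f j. The claim is M f = (X + 1) (L f + n X f)
    for the n-th iterate f of
  the constant sequence 1. It holds for n = 0, and it propagates because M L - L M = X M and M commutes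
  with multiplication by X.
\<close>

lemma block_poly_differential:
  "block_poly (Suc n) j = (X + 1)
      * (of_nat j * block_poly n (j - 1) + (of_nat (Suc j) + of_nat n * X) * block_poly n j
      + X * (1 - X) * pderiv (block_poly n j))"
proof (induction n arbitrary: j)
  case 0
  show ?case by (simp add: algebra_simps)
next
  case (Suc n)
  have dX: "pderiv X = 1" by (simp add: pderiv_pCons)
  have IH: "(X + 1) * (X * (1 - X)) * pderiv (block_poly n j)
      = block_poly (Suc n) j - (X + 1) * (of_nat j * block_poly n (j - 1) + (of_nat (Suc j) + of_nat n * X) * block_poly n j)" for j
    unfolding Suc.IH[of j] by (simp add: algebra_simps)
  have d: "pderiv (block_poly (Suc n) j)
      = of_nat (Suc j) * block_poly n (Suc j) + of_nat j * block_poly n j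
     + X * of_nat (Suc j) * pderiv (block_poly n (Suc j)) + ((X + 1) * of_nat j + 1) * pderiv (block_poly n j)
     + of_nat j * pderiv (block_poly n (j - 1))"
    by (simp add: pderiv_add pderiv_mult dX pderiv_of_nat algebra_simps del: mult_pCons_left mult_pCons_right of_nat_Suc)
  \<comment> \<open>With an opaque name for the variable, ring normalisation does not expand products with X
    into coefficient lists.\<close>
  define Y where "Y = X"
  have "(Y + 1) * (Y * (1 - Y) * pderiv (block_poly (Suc n) j))
     = (Y + 1) * (Y * (1 - Y)) * (of_nat (Suc j) * block_poly n (Suc j) + of_nat j * block_poly n j)
     + Y * of_nat (Suc j) * ((Y + 1) * (Y * (1 - Y)) * pderiv (block_poly n (Suc j)))
     + ((Y + 1) * of_nat j + 1) * ((Y + 1) * (Y * (1 - Y)) * pderiv (block_poly n j))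
     + of_nat j * ((Y + 1) * (Y * (1 - Y)) * pderiv (block_poly n (j - 1)))"
    unfolding d Y_def[symmetric] by (simp add: algebra_simps)
  then have e: "(Y + 1) * (Y * (1 - Y) * pderiv (block_poly (Suc n) j))
      = (Y + 1) * (Y * (1 - Y)) * (of_nat (Suc j) * block_poly n (Suc j) + of_nat j * block_poly n j)
     + Y * of_nat (Suc j) * (block_poly (Suc n) (Suc j) - (Y + 1) * (of_nat (Suc j) * block_poly n (Suc j - 1) + (of_nat (Suc (Suc j)) + of_nat n * Y) * block_poly n (Suc j)))
     + ((Y + 1) * of_nat j + 1) * (block_poly (Suc n) j - (Y + 1) * (of_nat j * block_poly n (j - 1) + (of_nat (Suc j) + of_nat n * Y) * block_poly n j))
     + of_nat j * (block_poly (Suc n) (j - 1) - (Y + 1) * (of_nat (j - 1) * block_poly n (j - 1 - 1) + (of_nat (Suc (j - 1)) + of_nat n * Y) * block_poly n (j - 1)))"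
    by (simp only: IH[folded Y_def])
  have r2: "block_poly (Suc (Suc n)) j
      = Y * of_nat (Suc j) * block_poly (Suc n) (Suc j) + ((Y + 1) * of_nat j + 1) * block_poly (Suc n) j
     + of_nat j * block_poly (Suc n) (j - 1)" unfolding Y_def by (rule block_poly.simps)
  have "(Y + 1) * (of_nat j * block_poly (Suc n) (j - 1)
      + (of_nat (Suc j) + of_nat (Suc n) * Y) * block_poly (Suc n) j
      + Y * (1 - Y) * pderiv (block_poly (Suc n) j)) = block_poly (Suc (Suc n)) j"
  proof (cases j)
    case 0
    then show ?thesis unfolding r2 distrib_left[of "Y+1"] e
      unfolding block_poly.simps(2) Y_def[symmetric]
      by (simp add: algebra_simps)
  next
    case j: (Suc i)
    show ?thesis
    proof (cases i)
      case 0
      then show ?thesis unfolding r2 distrib_left[of "Y+1"] e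
        unfolding block_poly.simps(2) Y_def[symmetric] j
        by (simp add: algebra_simps)
    next
      case (Suc k)
      then show ?thesis unfolding r2 distrib_left[of "Y+1"] e
        unfolding block_poly.simps(2) Y_def[symmetric] j
        by (simp add: algebra_simps)
    qed
  qed
  then show ?case unfolding Y_def by simp
qed

text \<open>
  The generating polynomial, by the number of rows still to be revealed, of the ways to continue when t
  border steps are left and m + 1 rows are open (row 0, which is always open, and m others).
\<close>

definition completion_poly :: "nat \<Rightarrow> nat \<Rightarrow> real poly" where
  "completion_poly t m = (\<Sum>j\<le>m. of_nat (surjections m j) * block_poly t j)"

lemma completion_poly_atMost:
  "m \<le> M \<Longrightarrow> completion_poly t m = (\<Sum>j\<le>M. of_nat (surjections m j) * block_poly t j)"
  unfolding completion_poly_def by (rule sum.mono_neutral_left) (auto simp: surjections_eq_0)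

lemma sum_choose_completion_poly:
  "(\<Sum>i<m. of_nat (m choose i) * completion_poly t i)
      = (\<Sum>j\<le>m. of_nat (surjections m (Suc j)) * block_poly t j)"
proof -
  have "(\<Sum>i<m. of_nat (m choose i) * completion_poly t i)
      = (\<Sum>i<m. \<Sum>j\<le>m. of_nat ((m choose i) * surjections i j) * block_poly t j)"
    by (intro sum.cong refl) (simp add: completion_poly_atMost[of _ m] sum_distrib_left algebra_simps)
  also have "\<dots> = (\<Sum>j\<le>m. of_nat (\<Sum>i<m. (m choose i) * surjections i j) * block_poly t j)"
    by (subst sum.swap) (simp add: sum_distrib_right)
  finally show ?thesis by (simp add: sum_choose_surjections)
qed

lemma completion_poly_0_0: "completion_poly 0 0 = 1" by (simp add: completion_poly_def)

text \<open>
  No border steps are left: the open row with the largest index is not available to its own column,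
  so that m rows remain, of which a nonempty set is chosen; i + 1 rows stay open when m - i of them
  are chosen.
\<close>

lemma completion_poly_0_rec: assumes "m > 0" shows "completion_poly 0 m
    = (\<Sum>i<m. of_nat (m choose i) * completion_poly 0 i)"
proof -
  have "completion_poly 0 m = (\<Sum>j\<le>Suc m. of_nat (surjections m j) * block_poly 0 j)"
    by (rule completion_poly_atMost) simp
  also have "\<dots> = (\<Sum>j\<le>m. of_nat (surjections m (Suc j)) * block_poly 0 j)"
    using assms by (subst sum.atMost_Suc_shift) (cases m; simp)
  finally show ?thesis by (simp only: sum_choose_completion_poly)
qed

text \<open>
  The next border step either reveals a new row, which is open and contributes a diagonal box, or a
  column with a nonempty set of points in the m + 1 open rows.
\<close>

lemma completion_poly_Suc_rec:
  "completion_poly (Suc t) m = X * completion_poly t (Suc m)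
      + (\<Sum>i\<le>m. of_nat (Suc m choose i) * completion_poly t i)"
proof -
  define Y where "Y = X"
  define s where "s j = (of_nat (surjections m j) :: real poly)" for j
  have z: "s j = 0" if "j > m" for j using that by (simp add: s_def surjections_eq_0)
  have "Y * completion_poly t (Suc m) + (\<Sum>i\<le>m. of_nat (Suc m choose i) * completion_poly t i)
     = (\<Sum>j\<le>Suc m. (Y * of_nat j * (s j + s (j - 1)) + of_nat (Suc j) * (s (Suc j) + s j)) * block_poly t j)"
    unfolding lessThan_Suc_atMost[symmetric, of m] unfolding sum_choose_completion_poly
    unfolding lessThan_Suc_atMost completion_poly_def s_def
    by (simp add: sum_distrib_left sum.distrib[symmetric] algebra_simps del: sum.atMost_Suc)
  also have "\<dots> = (\<Sum>j\<le>Suc m. s j * (((Y + 1) * of_nat j + 1) * block_poly t j))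
     + (\<Sum>j\<le>Suc m. s (j - 1) * (Y * of_nat j * block_poly t j)) + (\<Sum>j\<le>Suc m. s (Suc j) * (of_nat (Suc j) * block_poly t j))"
    by (simp add: sum.distrib[symmetric] algebra_simps del: sum.atMost_Suc)
  also have "(\<Sum>j\<le>Suc m. s (j - 1) * (Y * of_nat j * block_poly t j))
      = (\<Sum>j\<le>m. s j * (Y * of_nat (Suc j) * block_poly t (Suc j)))"
    by (subst sum.atMost_Suc_shift) simp
  also have "(\<Sum>j\<le>Suc m. s (Suc j) * (of_nat (Suc j) * block_poly t j))
      = (\<Sum>j\<le>Suc (Suc m). s j * (of_nat j * block_poly t (j - 1)))"
    by (subst (2) sum.atMost_Suc_shift) simp
  also have "\<dots> = (\<Sum>j\<le>m. s j * (of_nat j * block_poly t (j - 1)))"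
    by (simp add: z)
  also have "(\<Sum>j\<le>Suc m. s j * (((Y + 1) * of_nat j + 1) * block_poly t j))
      = (\<Sum>j\<le>m. s j * (((Y + 1) * of_nat j + 1) * block_poly t j))"
    by (simp add: z)
  also have "\<dots> + (\<Sum>j\<le>m. s j * (Y * of_nat (Suc j) * block_poly t (Suc j)))
      + (\<Sum>j\<le>m. s j * (of_nat j * block_poly t (j - 1))) = completion_poly (Suc t) m"
    unfolding completion_poly_def block_poly.simps s_def Y_def
    by (simp add: sum.distrib[symmetric] algebra_simps del: sum.atMost_Suc)
  finally show ?thesis unfolding Y_def by simp
qed

definition diagonal_poly :: "nat \<Rightarrow> real poly" where "diagonal_poly n = X * block_poly n 0"

text \<open>
  For j = 0 the differential recurrence involves no other index, and multiplication by X absorbs the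
  constant term of its coefficient.
\<close>

lemma diagonal_poly_Suc:
  "diagonal_poly (Suc n) = (X + 1)
      * (of_nat (Suc n) * X * diagonal_poly n + (1 - X) * (X * pderiv (diagonal_poly n)))"
proof -
  have d: "pderiv (diagonal_poly n) = block_poly n 0 + X * pderiv (block_poly n 0)"
    by (simp add: diagonal_poly_def pderiv_mult pderiv_pCons del: mult_pCons_left mult_pCons_right)
  show ?thesis unfolding d unfolding diagonal_poly_def block_poly_differential
    by (simp add: algebra_simps del: mult_pCons_left mult_pCons_right)
qed

definition diagonal_count :: "nat \<Rightarrow> nat \<Rightarrow> real" where "diagonal_count n k = coeff (diagonal_poly n) k"

lemma diagonal_count_0: "diagonal_count 0 k = (if k = 1 then 1 else 0)"
  by (simp add: diagonal_count_def diagonal_poly_def coeff_pCons split: nat.splits)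

lemma diagonal_count_Suc:
  "diagonal_count (Suc n) k = real k * diagonal_count n k
      + (if k \<ge> 1 then real (Suc n) * diagonal_count n (k - 1) else 0)
    + (if k \<ge> 2 then (real n + 3 - real k) * diagonal_count n (k - 2) else 0)"
proof -
  have e: "coeff (X * pderiv p) i = real i * coeff p i" for p i
    by (cases i) (simp_all add: coeff_pderiv)
  have s: "coeff (X * p) i = (case i of 0 \<Rightarrow> 0 | Suc j \<Rightarrow> coeff p j)" for p i
    by (simp add: coeff_pCons)
  have n: "coeff (of_nat m * X * p) i = real m * coeff (X * p) i" for m p i
    by (simp add: of_nat_poly coeff_pCons del: of_nat_Suc split: nat.splits)
  define Y where "Y = X"
  have "diagonal_count (Suc n) k
      = coeff (Y * (of_nat (Suc n) * Y * diagonal_poly n) + of_nat (Suc n) * Y * diagonal_poly n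
     + (Y * pderiv (diagonal_poly n) - Y * (Y * (Y * pderiv (diagonal_poly n))))) k"
    unfolding diagonal_count_def diagonal_poly_Suc Y_def[symmetric] by (simp add: algebra_simps)
  then show ?thesis
    unfolding Y_def coeff_add coeff_diff s n e diagonal_count_def
    by (auto split: nat.splits simp: coeff_pCons coeff_pderiv algebra_simps numeral_2_eq_2 simp del: mult_pCons_left mult_pCons_right)
qed

lemma diagonal_count_eq_0: "k > Suc n \<Longrightarrow> diagonal_count n k = 0"
proof (induction n arbitrary: k)
  case 0
  then show ?case by (simp add: diagonal_count_0)
next
  case (Suc n)
  then have "diagonal_count n k = 0" "diagonal_count n (k - 1) = 0" by simp_all
  moreover have "(real n + 3 - real k) * diagonal_count n (k - 2) = 0"
    using Suc by (cases "k = n + 3") simp_all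
  ultimately show ?case unfolding diagonal_count_Suc using Suc.prems by (simp del: mult_eq_0_iff)
qed

text \<open>
  The dual form of the recurrence of the coefficients: as an identity for sums against a test function
  it describes the law of the successor of each k.
\<close>

lemma sum_diagonal_count_Suc:
  fixes f :: "nat \<Rightarrow> 'a :: real_field"
  shows "(\<Sum>k\<le>Suc (Suc n). of_real (diagonal_count (Suc n) k) * f k)
    = (\<Sum>k\<le>Suc n. of_real (diagonal_count n k) * (of_nat k * f k + of_nat (Suc n) * f (Suc k) + (of_nat (Suc n) - of_nat k) * f (Suc (Suc k))))"
proof -
  let ?c = "\<lambda>k. of_real (diagonal_count n k) :: 'a"
  have "(\<Sum>k\<le>Suc (Suc n). of_real (diagonal_count (Suc n) k) * f k)
      = (\<Sum>k\<le>n+3. of_real (diagonal_count (Suc n) k) * f k)"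
    by (rule sum.mono_neutral_left) (auto simp: diagonal_count_eq_0)
  also have "\<dots> = (\<Sum>k\<le>n+3. ?c k * (of_nat k * f k))
      + (\<Sum>k\<le>n+3. (if k \<ge> 1 then ?c (k - 1) * (of_nat (Suc n) * f k) else 0))
      + (\<Sum>k\<le>n+3. (if k \<ge> 2 then ?c (k - 2) * ((of_nat n + 3 - of_nat k) * f k) else 0))"
    unfolding sum.distrib[symmetric]
    by (intro sum.cong refl) (auto simp: diagonal_count_Suc algebra_simps)
  also have "(\<Sum>k\<le>n+3. ?c k * (of_nat k * f k)) = (\<Sum>k\<le>Suc n. ?c k * (of_nat k * f k))"
    by (rule sum.mono_neutral_right) (auto simp: diagonal_count_eq_0)
  also have "(\<Sum>k\<le>n+3. (if k \<ge> 1 then ?c (k - 1) * (of_nat (Suc n) * f k) else 0))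
     = (\<Sum>k\<le>n+2. ?c k * (of_nat (Suc n) * f (Suc k)))"
  proof -
    have "n + 3 = Suc (n + 2)" by simp
    then show ?thesis by (simp only: sum.atMost_Suc_shift) simp
  qed
  also have "\<dots> = (\<Sum>k\<le>Suc n. ?c k * (of_nat (Suc n) * f (Suc k)))"
    by (rule sum.mono_neutral_right) (auto simp: diagonal_count_eq_0)
  also have "(\<Sum>k\<le>n+3. (if k \<ge> 2 then ?c (k - 2) * ((of_nat n + 3 - of_nat k) * f k) else 0))
     = (\<Sum>k\<le>Suc n. ?c k * ((of_nat (Suc n) - of_nat k) * f (Suc (Suc k))))"
    by (simp add: numeral_3_eq_3 numeral_2_eq_2 sum.atMost_Suc_shift del: sum.atMost_Suc)
  finally show ?thesis by (simp only: sum.distrib[symmetric] distrib_left[symmetric])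
qed

section \<open>Counting half tableaux by cutting off columns\<close>

lemma sum_nonempty_subsets:
  fixes f :: "nat \<Rightarrow> 'a :: comm_ring_1"
  assumes "finite A"
  shows "(\<Sum>S\<in>Pow A - {{}}. f (card A - card S)) = (\<Sum>i<card A. of_nat (card A choose i) * f i)"
proof -
  have "(\<Sum>S\<in>Pow A - {{}}. f (card A - card S)) = (\<Sum>T\<in>Pow A - {A}. f (card T))"
    by (rule sum.reindex_bij_witness[of _ "\<lambda>T. A - T" "\<lambda>S. A - S"])
       (use assms in \<open>auto simp: card_Diff_subset finite_subset double_diff\<close>)
  also have "\<dots> = (\<Sum>i<card A. \<Sum>T\<in>{T \<in> Pow A - {A}. card T = i}. f (card T))"
  proof (rule sum.group[symmetric])
    show "card ` (Pow A - {A}) \<subseteq> {..<card A}"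
      using assms by (auto intro!: psubset_card_mono)
  qed (use assms in auto)
  also have "\<dots> = (\<Sum>i<card A. of_nat (card A choose i) * f i)"
  proof (rule sum.cong[OF refl])
    fix i assume "i \<in> {..<card A}"
    then have "{T \<in> Pow A - {A}. card T = i} = {T. T \<subseteq> A \<and> card T = i}" by auto
    then show "(\<Sum>T\<in>{T \<in> Pow A - {A}. card T = i}. f (card T)) = of_nat (card A choose i) * f i"
      using n_subsets[OF assms, of i] by simp
  qed
  finally show ?thesis .
qed

definition covered :: "(nat \<times> nat) set \<Rightarrow> nat \<Rightarrow> nat \<Rightarrow> bool" where
  "covered Q i b \<longleftrightarrow> (i, b) \<in> Q \<and> (\<exists>a<i. (a, b) \<in> Q)"

text \<open>
  \<open>R\<close> is the set of open rows when the columns up to \<open>j\<close> remain. A row outside \<open>R\<close> already has its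
  covered point further to the right, so that its hook has no point in the remaining columns.
\<close>

definition half_filling :: "nat \<Rightarrow> nat set \<Rightarrow> (nat \<times> nat) set \<Rightarrow> bool" where
  "half_filling j R Q \<longleftrightarrow> Q \<subseteq> {(a, b). a < b \<and> b \<le> j} \<and>
     (\<forall>i\<in>{1..j}.
        (if i \<in> R then (\<forall>b b'. covered Q i b \<and> b' < b \<longrightarrow> (i, b') \<notin> Q) \<and>
                        ((\<exists>a. (a, i) \<in> Q) \<longleftrightarrow> \<not> (\<exists>b. covered Q i b))
         else (\<forall>b. (i, b) \<notin> Q) \<and> (\<forall>a. (a, i) \<notin> Q)))"

text \<open>
  The points of a new column in the rows \<open>S\<close> are covered except for the topmost one.
\<close>

definition remaining :: "nat set \<Rightarrow> nat set \<Rightarrow> nat set" where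
  "remaining R S = R - (S - {Min S})"

text \<open>
  The conditions on the rows up to \<open>j\<close> are unchanged by a new last column except in the rows where the
  column has a covered point: there everything to the left in the hook must be empty, which is the
  condition for a row that is not open. The row \<open>Suc j\<close> is empty, so its column is nonempty exactly if
  the row is open.
\<close>

lemma half_filling_add_column:
  assumes Q: "Q \<subseteq> {(a, b). b \<le> j}" and S: "S \<subseteq> {..j}" and R: "0 \<in> R"
  shows "half_filling (Suc j) R (Q \<union> S \<times> {Suc j}) \<longleftrightarrow>
    S \<subseteq> R \<and> (S \<noteq> {} \<longleftrightarrow> Suc j \<in> R) \<and> half_filling j (remaining R S) Q"
proof -
  let ?Q = "Q \<union> S \<times> {Suc j}"
  have fin: "finite S" using S finite_subset by blast
  have cov: "covered ?Q i b \<longleftrightarrow> (if b = Suc j then i \<in> S - {Min S} else covered Q i b)" for i b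
  proof (cases "b = Suc j")
    case True
    have "i \<in> S \<and> (\<exists>a<i. a \<in> S) \<longleftrightarrow> i \<in> S - {Min S}"
      using fin by (metis Diff_iff Min_in Min_le antisym_conv3 empty_iff leD order_le_imp_less_or_eq singletonD singletonI)
    then show ?thesis using True Q by (auto simp: covered_def)
  next
    case False
    then show ?thesis by (auto simp: covered_def)
  qed
  have noQ: "(i, Suc j) \<notin> Q" for i using Q by auto
  have notS: "Suc j \<notin> S" using S by auto
  show ?thesis (is "?L \<longleftrightarrow> ?R")
  proof
    assume L: ?L
    have sub: "Q \<subseteq> {(a, b). a < b \<and> b \<le> j}" using L Q unfolding half_filling_def by auto
    have lo: "if i \<in> R then (\<forall>b b'. covered ?Q i b \<and> b' < b \<longrightarrow> (i, b') \<notin> ?Q) \<and>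
                        ((\<exists>a. (a, i) \<in> ?Q) \<longleftrightarrow> \<not> (\<exists>b. covered ?Q i b))
         else (\<forall>b. (i, b) \<notin> ?Q) \<and> (\<forall>a. (a, i) \<notin> ?Q)" if "i \<in> {1..Suc j}" for i
      using L that unfolding half_filling_def by blast
    have SR: "S \<subseteq> R"
    proof
      fix i assume i: "i \<in> S"
      show "i \<in> R"
      proof (cases "i = 0")
        case False
        then have "i \<in> {1..Suc j}" using i S by auto
        from lo[OF this] i show ?thesis by (auto split: if_splits)
      qed (use R in simp)
    qed
    have row: "(Suc j, b) \<notin> ?Q" for b using sub notS by auto
    have top: "S \<noteq> {} \<longleftrightarrow> Suc j \<in> R"
      using lo[of "Suc j"] row noQ by (auto simp: covered_def split: if_splits)
    have "half_filling j (remaining R S) Q"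
      unfolding half_filling_def
    proof (intro conjI sub ballI)
      fix i assume i: "i \<in> {1..j}"
      then have i': "i \<in> {1..Suc j}" "i \<noteq> Suc j" by auto
      note l = lo[OF i'(1)]
      show "if i \<in> remaining R S then (\<forall>b b'. covered Q i b \<and> b' < b \<longrightarrow> (i, b') \<notin> Q) \<and>
                        ((\<exists>a. (a, i) \<in> Q) \<longleftrightarrow> \<not> (\<exists>b. covered Q i b))
         else (\<forall>b. (i, b) \<notin> Q) \<and> (\<forall>a. (a, i) \<notin> Q)"
      proof (cases "i \<in> R")
        case False
        then show ?thesis using l by (auto simp: remaining_def)
      next
        case True
        show ?thesis
        proof (cases "i \<in> S - {Min S}")
          case T: True
          then have cj: "covered ?Q i (Suc j)" using cov by auto
          have "(i, b) \<notin> Q" for b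
          proof (cases "b < Suc j")
            case True
            then show ?thesis using l \<open>i \<in> R\<close> cj by auto
          qed (use sub in auto)
          moreover have "(a, i) \<notin> Q" for a using l \<open>i \<in> R\<close> cj by auto
          ultimately show ?thesis using T by (auto simp: remaining_def)
        next
          case F: False
          then have "covered ?Q i b \<longleftrightarrow> covered Q i b" for b using cov noQ by (auto simp: covered_def)
          then show ?thesis using l True F i' by (auto simp: remaining_def)
        qed
      qed
    qed
    with SR top show ?R by blast
  next
    assume R': ?R
    then have SR: "S \<subseteq> R" and top: "S \<noteq> {} \<longleftrightarrow> Suc j \<in> R" and hf: "half_filling j (remaining R S) Q"
      by auto
    have sub: "Q \<subseteq> {(a, b). a < b \<and> b \<le> j}" using hf unfolding half_filling_def by auto
    have lo: "if i \<in> remaining R S then (\<forall>b b'. covered Q i b \<and> b' < b \<longrightarrow> (i, b') \<notin> Q) \<and>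
                        ((\<exists>a. (a, i) \<in> Q) \<longleftrightarrow> \<not> (\<exists>b. covered Q i b))
         else (\<forall>b. (i, b) \<notin> Q) \<and> (\<forall>a. (a, i) \<notin> Q)" if "i \<in> {1..j}" for i
      using hf that unfolding half_filling_def by blast
    have row: "(Suc j, b) \<notin> ?Q" for b using sub notS by auto
    show ?L unfolding half_filling_def
    proof (intro conjI ballI)
      show "?Q \<subseteq> {(a, b). a < b \<and> b \<le> Suc j}" using sub S by auto
      fix i assume i: "i \<in> {1..Suc j}"
      show "if i \<in> R then (\<forall>b b'. covered ?Q i b \<and> b' < b \<longrightarrow> (i, b') \<notin> ?Q) \<and>
                        ((\<exists>a. (a, i) \<in> ?Q) \<longleftrightarrow> \<not> (\<exists>b. covered ?Q i b))
         else (\<forall>b. (i, b) \<notin> ?Q) \<and> (\<forall>a. (a, i) \<notin> ?Q)"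
      proof (cases "i = Suc j")
        case True
        then show ?thesis using row top noQ by (auto simp: covered_def)
      next
        case False
        with i have i': "i \<in> {1..j}" by auto
        note l = lo[OF i']
        show ?thesis
        proof (cases "i \<in> R")
          case nR: False
          then show ?thesis using l SR False by (auto simp: remaining_def)
        next
          case iR: True
          show ?thesis
          proof (cases "i \<in> S - {Min S}")
            case T: True
            then have e: "(i, b) \<notin> Q" "(a, i) \<notin> Q" for a b using l by (auto simp: remaining_def)
            have "covered ?Q i b \<longleftrightarrow> b = Suc j" for b using cov[of i b] T e by (auto simp: covered_def)
            then show ?thesis using iR e False by auto
          next
            case F: False
            then have c: "covered ?Q i b \<longleftrightarrow> covered Q i b" for b using cov noQ
              by (auto simp: covered_def)
            have "(i, b') \<notin> S \<times> {Suc j}" if "covered Q i b" "b' < b" for b b'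
              using that sub by (auto simp: covered_def)
            then show ?thesis using l iR F False c by (auto simp: remaining_def)
          qed
        qed
      qed
    qed
  qed
qed

text \<open>
  A point in row 0 is never covered.
\<close>

lemma zero_in_remaining:
  assumes "0 \<in> R" "finite S"
  shows "0 \<in> remaining R S"
proof -
  have "Min S = 0" if "0 \<in> S" using Min_le[OF assms(2) that] by simp
  then show ?thesis using assms(1) by (cases "0 \<in> S") (simp_all add: remaining_def)
qed

lemma card_remaining:
  assumes "finite A" "S \<subseteq> R \<inter> A" "S \<noteq> {}"
  shows "card (remaining R S \<inter> A) - 1 = card (R \<inter> A) - card S"
proof -
  have f: "finite (R \<inter> A)" "finite S" using assms finite_subset by auto
  have m: "Min S \<in> S" using f assms by simp
  have "remaining R S \<inter> A = (R \<inter> A) - (S - {Min S})" by (auto simp: remaining_def)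
  then have "card (remaining R S \<inter> A) = card (R \<inter> A) - card (S - {Min S})"
    using assms f by (simp add: card_Diff_subset subset_iff)
  also have "card (S - {Min S}) = card S - 1" using m f by simp
  finally show ?thesis using card_mono[OF f(1) assms(2)] f assms(3)
    by (simp add: Suc_le_eq card_gt_0_iff)
qed

text \<open>
  The fillings of the full triangle. Only the number of open rows matters, since the column of an open
  row j picks a nonempty set among the open rows above it and the column of any other row is empty.
\<close>

lemma card_half_fillings:
  assumes "0 \<in> R"
  shows "finite {Q. half_filling j R Q} \<and> of_nat (card {Q. half_filling j R Q})
      = completion_poly 0 (card (R \<inter> {..j}) - 1)"
  using assms
proof (induction j arbitrary: R)
  case 0
  have "{Q. half_filling 0 R Q} = {{}}" by (auto simp: half_filling_def)
  moreover have "R \<inter> {..0} = {0}" using 0 by auto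
  ultimately show ?case by (simp add: completion_poly_0_0)
next
  case (Suc j)
  define A where "A = R \<inter> {..j}"
  have A: "finite A" "card A > 0" using Suc.prems by (auto simp: A_def card_gt_0_iff)
  define T where "T = {S. S \<subseteq> A \<and> (S \<noteq> {} \<longleftrightarrow> Suc j \<in> R)}"
  have T: "finite T" "T \<subseteq> Pow A" using A by (auto simp: T_def)
  let ?F = "\<lambda>S. {Q. half_filling j (remaining R S) Q}"
  have T0: "0 \<in> remaining R S" if "S \<in> T" for S
  proof (rule zero_in_remaining[OF Suc.prems])
    show "finite S" using that T(2) A(1) finite_subset by blast
  qed
  have IH: "finite (?F S)" "of_nat (card (?F S))
      = completion_poly 0 (card (remaining R S \<inter> {..j}) - 1)" if "S \<in> T" for S
    using Suc.IH[OF T0[OF that]] by auto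
  have bij: "bij_betw (\<lambda>(S, Q). Q \<union> S \<times> {Suc j}) (SIGMA S:T. ?F S) {Q. half_filling (Suc j) R Q}"
  proof (rule bij_betwI[where g = "\<lambda>Q. ({a. (a, Suc j) \<in> Q}, {(a, b) \<in> Q. b \<le> j})"])
    show "(\<lambda>(S, Q). Q \<union> S \<times> {Suc j}) \<in> (SIGMA S:T. ?F S) \<rightarrow> {Q. half_filling (Suc j) R Q}"
    proof clarsimp
      fix S Q assume h: "S \<in> T" "half_filling j (remaining R S) Q"
      then have "Q \<subseteq> {(a, b). b \<le> j}" by (auto simp: half_filling_def)
      from half_filling_add_column[OF this _ Suc.prems, of S] h show "half_filling (Suc j) R (Q
          \<union> S \<times> {Suc j})"
        by (auto simp: T_def A_def)
    qed
    show "(\<lambda>Q. ({a. (a, Suc j) \<in> Q}, {(a, b) \<in> Q. b \<le> j}))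
        \<in> {Q. half_filling (Suc j) R Q} \<rightarrow> (SIGMA S:T. ?F S)"
    proof (rule funcsetI)
      fix Q assume "Q \<in> {Q. half_filling (Suc j) R Q}"
      then have h: "half_filling (Suc j) R Q" by simp
      let ?S = "{a. (a, Suc j) \<in> Q}" and ?Q = "{(a, b) \<in> Q. b \<le> j}"
      have s: "?S \<subseteq> {..j}" using h by (auto simp: half_filling_def)
      have e: "Q = ?Q \<union> ?S \<times> {Suc j}" using h by (auto simp: half_filling_def le_Suc_eq)
      have q: "?Q \<subseteq> {(a, b). b \<le> j}" by auto
      have "half_filling (Suc j) R (?Q \<union> ?S \<times> {Suc j})" using h e by metis
      from half_filling_add_column[OF q s Suc.prems, THEN iffD1, OF this] s
      show "(?S, ?Q) \<in> (SIGMA S:T. ?F S)" by (auto simp: T_def A_def)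
    qed
    show "({a. (a, Suc j) \<in> (\<lambda>(S, Q). Q \<union> S \<times> {Suc j}) x}, {(a, b) \<in> (\<lambda>(S, Q). Q \<union> S \<times> {Suc j}) x. b
        \<le> j}) = x"
      if "x \<in> (SIGMA S:T. ?F S)" for x
      using that by (auto simp: half_filling_def)
    show "(\<lambda>(S, Q). Q \<union> S \<times> {Suc j}) ({a. (a, Suc j) \<in> Q}, {(a, b) \<in> Q. b \<le> j}) = Q"
      if "Q \<in> {Q. half_filling (Suc j) R Q}" for Q
      using that by (auto simp: half_filling_def le_Suc_eq)
  qed
  have fin: "finite {Q. half_filling (Suc j) R Q}"
    using bij_betw_finite[OF bij] T IH by auto
  have "card {Q. half_filling (Suc j) R Q} = (\<Sum>S\<in>T. card (?F S))"
    using bij_betw_same_card[OF bij] T(1) IH(1) by (simp add: card_SigmaI)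
  then have "of_nat (card {Q. half_filling (Suc j) R Q}) = (\<Sum>S\<in>T. of_nat (card (?F S)) :: real poly)"
    by simp
  also have "\<dots> = (\<Sum>S\<in>T. completion_poly 0 (card (remaining R S \<inter> {..j}) - 1))"
    by (intro sum.cong refl IH)
  also have "\<dots> = completion_poly 0 (card (R \<inter> {..Suc j}) - 1)"
  proof (cases "Suc j \<in> R")
    case False
    then have "T = {{}}" by (auto simp: T_def)
    moreover have "R \<inter> {..Suc j} = R \<inter> {..j}" using False by (auto simp: le_Suc_eq)
    ultimately show ?thesis by (simp add: remaining_def)
  next
    case True
    then have TA: "T = Pow A - {{}}" by (auto simp: T_def)
    have "R \<inter> {..Suc j} = insert (Suc j) A" using True by (auto simp: A_def le_Suc_eq)
    then have c: "card (R \<inter> {..Suc j}) - 1 = card A" using A by (simp add: A_def)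
    have "(\<Sum>S\<in>T. completion_poly 0 (card (remaining R S \<inter> {..j}) - 1))
        = (\<Sum>S\<in>Pow A - {{}}. completion_poly 0 (card A - card S))"
      unfolding TA
    proof (intro sum.cong refl arg_cong[of _ _ "completion_poly 0"])
      fix S assume "S \<in> Pow A - {{}}"
      then show "card (remaining R S \<inter> {..j}) - 1 = card A - card S"
        unfolding A_def by (intro card_remaining) auto
    qed
    also have "\<dots> = completion_poly 0 (card A)"
      unfolding sum_nonempty_subsets[OF A(1)] by (rule completion_poly_0_rec[OF A(2), symmetric])
    finally show ?thesis unfolding c .
  qed
  finally show ?case using fin by blast
qed

text \<open>
  The half diagrams with columns up to \<open>j\<close> whose last column has height at least \<open>h\<close>. Following the
  border from the top right corner, each step increases \<open>h\<close> or decreases \<open>j\<close>, until the border meets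
  the diagonal at \<open>h = Suc j\<close>.
\<close>

definition half_shape :: "nat \<Rightarrow> nat \<Rightarrow> (nat \<times> nat) set \<Rightarrow> bool" where
  "half_shape j h U \<longleftrightarrow> U \<subseteq> {(a, b). a \<le> b \<and> b \<le> j} \<and>
     (\<forall>a b a'. (a, b) \<in> U \<and> a' \<le> a \<longrightarrow> (a', b) \<in> U) \<and>
     (\<forall>a b b'. (a, b) \<in> U \<and> a \<le> b' \<and> b' \<le> b \<longrightarrow> (a, b') \<in> U) \<and>
     (\<forall>a<h. (a, j) \<in> U)"

definition half_tableaux :: "nat \<Rightarrow> nat \<Rightarrow> nat set \<Rightarrow> tableau set" where
  "half_tableaux j h R = {(U, Q). half_shape j h U \<and> Q \<subseteq> U \<and> half_filling j R Q}"

definition diag_poly :: "tableau set \<Rightarrow> real poly" where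
  "diag_poly \<T> = (\<Sum>T\<in>\<T>. monom 1 (diagonal_boxes T))"

lemma finite_half_tableaux: "finite (half_tableaux j h R)"
proof (rule finite_subset)
  let ?V = "{(a, b). a \<le> b \<and> b \<le> j}"
  show "half_tableaux j h R \<subseteq> Pow ?V \<times> Pow ?V"
    unfolding half_tableaux_def half_shape_def by blast
  have "?V \<subseteq> {..j} \<times> {..j}" by auto
  then have "finite ?V" by (rule finite_subset) simp
  then show "finite (Pow ?V \<times> Pow ?V)" by simp
qed

lemma half_shape_full:
  "half_shape j (Suc j) U \<longleftrightarrow> U = {(a, b). a \<le> b \<and> b \<le> j}"
proof
  assume h: "half_shape j (Suc j) U"
  have jj: "(a, j) \<in> U" if "a < Suc j" for a using h that unfolding half_shape_def by blast
  have left: "(a, b') \<in> U" if "(a, b) \<in> U" "a \<le> b'" "b' \<le> b" for a b b'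
    using h that unfolding half_shape_def by blast
  have "(a, b) \<in> U" if "a \<le> b" "b \<le> j" for a b
    using left[OF jj that] that by simp
  moreover have "U \<subseteq> {(a, b). a \<le> b \<and> b \<le> j}" using h unfolding half_shape_def by blast
  ultimately show "U = {(a, b). a \<le> b \<and> b \<le> j}" by auto
next
  assume "U = {(a, b). a \<le> b \<and> b \<le> j}"
  then show "half_shape j (Suc j) U" by (simp add: half_shape_def)
qed

lemma half_shape_add_column:
  assumes U: "U \<subseteq> {(a, b). b \<le> j}" and h: "h \<le> Suc j"
  shows "half_shape (Suc j) h (U \<union> {..<h} \<times> {Suc j}) \<longleftrightarrow> half_shape j h U" (is "?L \<longleftrightarrow> ?R")
proof
  assume L: ?L
  have no: "(a, Suc j) \<notin> U" for a using U by auto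
  let ?U = "U \<union> {..<h} \<times> {Suc j}"
  have up: "(a', b) \<in> ?U" if "(a, b) \<in> ?U" "a' \<le> a" for a b a'
    using L that unfolding half_shape_def by blast
  have left: "(a, b') \<in> ?U" if "(a, b) \<in> ?U" "a \<le> b'" "b' \<le> b" for a b b'
    using L that unfolding half_shape_def by blast
  show ?R unfolding half_shape_def
  proof (intro conjI allI impI; (elim conjE)?)
    show "U \<subseteq> {(a, b). a \<le> b \<and> b \<le> j}" using L U unfolding half_shape_def by auto
    show "(a', b) \<in> U" if "(a, b) \<in> U" "a' \<le> a" for a b a'
      using up[of a b a'] that U by auto
    show "(a, b') \<in> U" if "(a, b) \<in> U" "a \<le> b'" "b' \<le> b" for a b b'
      using left[of a b b'] that U by auto
    show "(a, j) \<in> U" if "a < h" for a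
      using left[of a "Suc j" j] that h by auto
  qed
next
  assume R: ?R
  have up: "(a', b) \<in> U" if "(a, b) \<in> U" "a' \<le> a" for a b a'
    using R that unfolding half_shape_def by blast
  have left: "(a, b') \<in> U" if "(a, b) \<in> U" "a \<le> b'" "b' \<le> b" for a b b'
    using R that unfolding half_shape_def by blast
  have col: "(a, b) \<in> U" if "a < h" "a \<le> b" "b \<le> j" for a b
    using R that left[of a j b] unfolding half_shape_def by blast
  have sub: "U \<subseteq> {(a, b). a \<le> b \<and> b \<le> j}" using R unfolding half_shape_def by blast
  show ?L unfolding half_shape_def
  proof (intro conjI allI impI; (elim conjE)?)
    show "U \<union> {..<h} \<times> {Suc j} \<subseteq> {(a, b). a \<le> b \<and> b \<le> Suc j}"
      using sub h by auto
    show "(a', b) \<in> U \<union> {..<h} \<times> {Suc j}" if "(a, b) \<in> U \<union> {..<h} \<times> {Suc j}" "a' \<le> a" for a b a'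
      using that up[of a b a'] by auto
    show "(a, b') \<in> U \<union> {..<h} \<times> {Suc j}" if "(a, b) \<in> U \<union> {..<h} \<times> {Suc j}" "a \<le> b'"
        "b' \<le> b" for a b b'
      using that left[of a b b'] col[of a b'] by (auto simp: le_Suc_eq)
    show "(a, Suc j) \<in> U \<union> {..<h} \<times> {Suc j}" if "a < h" for a using that by simp
  qed
qed

lemma half_shape_Suc: "half_shape j (Suc h) U \<longleftrightarrow> half_shape j h U \<and> (h, j) \<in> U"
  unfolding half_shape_def less_Suc_eq by blast

lemma half_shape_column:
  assumes "half_shape (Suc j) h U" "(h, Suc j) \<notin> U"
  shows "U = {(a, b) \<in> U. b \<le> j} \<union> {..<h} \<times> {Suc j}"
proof -
  have "a < h" if "(a, Suc j) \<in> U" for a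
  proof (rule ccontr)
    assume "\<not> a < h"
    moreover have "\<forall>a b a'. (a, b) \<in> U \<and> a' \<le> a \<longrightarrow> (a', b) \<in> U"
      using assms(1) unfolding half_shape_def by (elim conjE)
    ultimately show False using that assms(2) by (meson not_le)
  qed
  moreover have "(a, Suc j) \<in> U" if "a < h" for a
    using that assms(1) unfolding half_shape_def by blast
  moreover have "U \<subseteq> {(a, b). a \<le> b \<and> b \<le> Suc j}" using assms(1) unfolding half_shape_def by blast
  ultimately show ?thesis by (auto simp: le_Suc_eq)
qed

text \<open>
  Induction on the number t of border steps left. For t > 0 either the last column is higher than h,
  and h is revealed as a new row, or its height is h; in the latter case cutting it off is a bijection
  onto the pairs of a nonempty set of open rows and a smaller half tableau. The rows from h to j are
  all open because no column seen so far reaches them.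
\<close>

lemma diag_poly_half_tableaux:
  assumes "0 \<in> R" "{h..j} \<subseteq> R" "1 \<le> h" "h + t = Suc j"
  shows "diag_poly (half_tableaux j h R) = monom 1 h * completion_poly t (card (R \<inter> {..<h}) - 1)"
  using assms
proof (induction t arbitrary: j h R)
  case 0
  let ?V = "{(a, b). a \<le> b \<and> b \<le> j}"
  have h: "h = Suc j" using 0 by simp
  have "half_tableaux j h R = {?V} \<times> {Q. half_filling j R Q}"
    unfolding half_tableaux_def h half_shape_full by (auto simp: half_filling_def)
  moreover have "diagonal_boxes (?V, Q) = h" for Q
  proof -
    have "{c \<in> ?V. fst c = snd c} = (\<lambda>i. (i, i)) ` {..j}" by auto
    then show ?thesis by (simp add: diagonal_boxes_def card_image inj_on_def h)
  qed
  ultimately have "diag_poly (half_tableaux j h R) = (\<Sum>T\<in>{?V} \<times> {Q. half_filling j R Q}. monom 1 h)"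
    unfolding diag_poly_def by (intro sum.cong) auto
  also have "\<dots> = of_nat (card {Q. half_filling j R Q}) * monom 1 h"
    by (simp add: card_cartesian_product_singleton)
  finally show ?case using card_half_fillings[OF 0(1), of j]
    by (simp add: h lessThan_Suc_atMost mult.commute)
next
  case (Suc t)
  obtain i where j: "j = Suc i" using Suc.prems by (cases j) auto
  define A where "A = R \<inter> {..<h}"
  have A: "finite A" "card A > 0" using Suc.prems by (auto simp: A_def card_gt_0_iff)
  define m where "m = card A - 1"
  have m: "card A = Suc m" using A by (simp add: m_def)
  have hR: "h \<in> R" "Suc i \<in> R" "h \<le> Suc i" using Suc.prems j by auto
  define Z where "Z = {(U, Q) \<in> half_tableaux j h R. (h, j) \<notin> U}"
  define T where "T = Pow A - {{}}"
  let ?f = "\<lambda>(S, U, Q). (U \<union> {..<h} \<times> {j}, Q \<union> S \<times> {j})"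
  have TS: "S \<subseteq> {..i}" "S \<subseteq> R" "S \<noteq> {}" "S \<subseteq> {..<h}" if "S \<in> T" for S
    using that hR by (auto simp: T_def A_def)
  have split: "half_tableaux j h R = half_tableaux j (Suc h) R \<union> Z"
    by (auto simp: Z_def half_tableaux_def half_shape_Suc)
  have disj: "half_tableaux j (Suc h) R \<inter> Z = {}"
    by (auto simp: Z_def half_tableaux_def half_shape_Suc)
  have finZ: "finite Z" unfolding Z_def
    by (rule finite_subset[OF _ finite_half_tableaux[of j h R]]) auto
  have Zeq: "diag_poly Z
      = (\<Sum>x\<in>(SIGMA S:T. half_tableaux i h (remaining R S)). monom 1 (diagonal_boxes (snd x)))"
    unfolding diag_poly_def
  proof (rule sum.reindex_bij_witness[where i = ?f and
      j = "\<lambda>(U, Q). ({a. (a, j) \<in> Q}, {(a, b) \<in> U. b \<le> i}, {(a, b) \<in> Q. b \<le> i})"])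
    fix x assume "x \<in> Z"
    then obtain U Q where x: "x = (U, Q)" and U: "half_shape j h U" "(h, j) \<notin> U" and Q: "Q \<subseteq> U"
        "half_filling j R Q"
      by (auto simp: Z_def half_tableaux_def)
    let ?S = "{a. (a, Suc i) \<in> Q}" and ?U = "{(a, b) \<in> U. b \<le> i}" and ?Q = "{(a, b) \<in> Q. b \<le> i}"
    have Ue: "?U \<union> {..<h} \<times> {Suc i} = U" using half_shape_column[of i h U] U unfolding j by simp
    have Qe: "?Q \<union> ?S \<times> {Suc i} = Q" using Q unfolding half_filling_def j by (auto simp: le_Suc_eq)
    show "?f ((\<lambda>(U, Q). ({a. (a, j) \<in> Q}, {(a, b) \<in> U. b \<le> i}, {(a, b) \<in> Q. b \<le> i})) x) = x"
      unfolding x prod.case j Ue Qe ..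
    have Sh: "?S \<subseteq> {..<h}"
    proof
      fix a assume "a \<in> ?S"
      then have "(a, Suc i) \<in> U" using Q by auto
      then have "(a, Suc i) \<in> ?U \<union> {..<h} \<times> {Suc i}" unfolding Ue .
      then show "a \<in> {..<h}" by auto
    qed
    have "half_shape i h ?U"
      using half_shape_add_column[of ?U i h] U hR unfolding Ue j by auto
    moreover have "?S \<subseteq> R \<and> (?S \<noteq> {} \<longleftrightarrow> Suc i \<in> R) \<and> half_filling i (remaining R ?S) ?Q"
    proof (rule half_filling_add_column[THEN iffD1])
      show "half_filling (Suc i) R (?Q \<union> ?S \<times> {Suc i})" using Q(2) unfolding Qe j .
      show "?S \<subseteq> {..i}" using Sh hR(3) by auto
    qed (use Suc.prems(1) in auto)
    ultimately show "(\<lambda>(U, Q). ({a. (a, j) \<in> Q}, {(a, b) \<in> U. b \<le> i}, {(a, b) \<in> Q. b \<le> i})) x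
        \<in> (SIGMA S:T. half_tableaux i h (remaining R S))"
      unfolding x j using Sh hR Q by (auto simp: half_tableaux_def T_def A_def)
    have "(Suc i, Suc i) \<notin> U"
    proof
      assume "(Suc i, Suc i) \<in> U"
      then have "(Suc i, Suc i) \<in> ?U \<union> {..<h} \<times> {Suc i}" unfolding Ue .
      then show False using hR by auto
    qed
    moreover have "U \<subseteq> {(a, b). b \<le> Suc i}" using U unfolding half_shape_def j by blast
    ultimately have "{c \<in> U. fst c = snd c} = {c \<in> ?U. fst c = snd c}"
      by (auto simp: le_Suc_eq)
    then show "monom 1 (diagonal_boxes (snd ((\<lambda>(U, Q). ({a. (a, j) \<in> Q}, {(a, b) \<in> U. b \<le> i}, {(a, b)
        \<in> Q. b \<le> i})) x))) = (monom 1 (diagonal_boxes x) :: real poly)"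
      unfolding x by (simp add: diagonal_boxes_def)
  next
    fix y assume "y \<in> (SIGMA S:T. half_tableaux i h (remaining R S))"
    then obtain S U Q where y: "y = (S, U, Q)" and S: "S \<in> T" and U: "half_shape i h U"
        and Q: "Q \<subseteq> U" "half_filling i (remaining R S) Q"
      by (auto simp: half_tableaux_def)
    have Ui: "U \<subseteq> {(a, b). b \<le> i}" and Qi: "Q \<subseteq> {(a, b). b \<le> i}"
      using U Q by (auto simp: half_shape_def)
    show "(\<lambda>(U, Q). ({a. (a, j) \<in> Q}, {(a, b) \<in> U. b \<le> i}, {(a, b) \<in> Q. b \<le> i})) (?f y) = y"
      unfolding y j using Ui Qi by auto
    have "half_shape j h (U \<union> {..<h} \<times> {j})" unfolding j using half_shape_add_column[OF Ui] U hR
      by simp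
    moreover have "half_filling j R (Q \<union> S \<times> {j})"
      unfolding j using half_filling_add_column[OF Qi TS(1)[OF S] Suc.prems(1)] TS[OF S] hR Q by auto
    moreover have "(h, j) \<notin> U \<union> {..<h} \<times> {j}" using Ui j by auto
    ultimately show "?f y \<in> Z" unfolding y Z_def using Q TS[OF S] by (auto simp: half_tableaux_def)
  qed
  have "diag_poly Z = (\<Sum>S\<in>T. diag_poly (half_tableaux i h (remaining R S)))"
    unfolding Zeq unfolding diag_poly_def using A
    by (subst sum.Sigma) (auto simp: T_def finite_half_tableaux split_beta)
  also have "\<dots> = (\<Sum>S\<in>Pow A - {{}}. monom 1 h * completion_poly t (card A - card S))"
    unfolding T_def[symmetric]
  proof (rule sum.cong[OF refl])
    fix S assume S: "S \<in> T"
    have "{h..i} \<subseteq> remaining R S" using TS(4)[OF S] Suc.prems j by (fastforce simp: remaining_def)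
    then have "diag_poly (half_tableaux i h (remaining R S))
        = monom 1 h * completion_poly t (card (remaining R S \<inter> {..<h}) - 1)"
      using Suc.prems j by (intro Suc.IH zero_in_remaining finite_subset[OF TS(1)[OF S]]) auto
    then show "diag_poly (half_tableaux i h (remaining R S))
        = monom 1 h * completion_poly t (card A - card S)"
      using card_remaining[of "{..<h}" S R] TS[OF S] by (simp add: A_def)
  qed
  also have "\<dots> = monom 1 h * (\<Sum>i<card A. of_nat (card A choose i) * completion_poly t i)"
    unfolding sum_distrib_left[symmetric] sum_nonempty_subsets[OF A(1)] ..
  finally have Z: "diag_poly Z = monom 1 h * (\<Sum>i\<le>m. of_nat (Suc m choose i) * completion_poly t i)"
    unfolding m lessThan_Suc_atMost .
  have "R \<inter> {..<Suc h} = insert h A" using hR by (auto simp: A_def)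
  then have c: "card (R \<inter> {..<Suc h}) - 1 = Suc m" using A m by (simp add: A_def)
  have "diag_poly (half_tableaux j h R) = diag_poly (half_tableaux j (Suc h) R) + diag_poly Z"
    unfolding split diag_poly_def by (rule sum.union_disjoint[OF finite_half_tableaux finZ disj])
  also have "diag_poly (half_tableaux j (Suc h) R) = monom 1 (Suc h) * completion_poly t (Suc m)"
    unfolding c[symmetric] using Suc.prems by (intro Suc.IH) auto
  also have "(monom 1 (Suc h) :: real poly) = monom 1 h * X"
    by (simp add: monom_Suc)
  finally have "diag_poly (half_tableaux j h R) = monom 1 h * completion_poly (Suc t) m"
    unfolding Z completion_poly_Suc_rec by (simp only: distrib_left mult.assoc)
  then show ?case unfolding m_def A_def .
qed

section \<open>Folding a symmetric tableau along its diagonal\<close>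

lemma down_closed_eq_lessThan:
  fixes A :: "nat set"
  assumes "finite A" "\<And>x y. x \<in> A \<Longrightarrow> y \<le> x \<Longrightarrow> y \<in> A"
  shows "A = {..<card A}"
proof (cases "A = {}")
  case False
  then have "Max A \<in> A" using assms(1) by (rule Max_in[rotated])
  then have "{..Max A} \<subseteq> A" using assms(2) by auto
  moreover have "A \<subseteq> {..Max A}" using Max_ge[OF assms(1)] by auto
  ultimately have "A = {..Max A}" by (rule subset_antisym[rotated])
  then have "card A = Suc (Max A)" using card_atMost by metis
  with \<open>A = {..Max A}\<close> show ?thesis by (metis lessThan_Suc_atMost)
qed simp

lemma relation_eq_iff: "(r :: ('a \<times> 'b) set) = s \<longleftrightarrow> (\<forall>a b. (a, b) \<in> r \<longleftrightarrow> (a, b) \<in> s)"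
  by auto

definition fold_tableau :: "tableau \<Rightarrow> tableau" where
  "fold_tableau = (\<lambda>(D, P). ({(a, b) \<in> D. a \<le> b}, {(a, b) \<in> P. a < b}))"

definition unfold_tableau :: "tableau \<Rightarrow> tableau" where
  "unfold_tableau = (\<lambda>(U, Q). (U \<union> U\<inverse>, insert (0, 0) (Q \<union> Q\<inverse>)))"

lemma symmetric_tableauD:
  assumes "(D, P) \<in> symmetric_tree_like_tableaux (2 * n + 1)"
  shows "ferrers_diagram D" "Domain D = {..n}" "Range D = {..n}" "P \<subseteq> D" "(0, 0) \<in> P"
    "\<And>i. i \<in> Domain D \<Longrightarrow> \<exists>j. (i, j) \<in> P"
    "\<And>i j. (i, j) \<in> P \<Longrightarrow> (i, j) \<noteq> (0, 0) \<Longrightarrow> (\<forall>i'<i. (i', j) \<notin> P) \<longleftrightarrow> \<not> (\<forall>j'<j. (i, j') \<notin> P)"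
    "\<And>i j. (i, j) \<in> D \<longleftrightarrow> (j, i) \<in> D" "\<And>i j. (i, j) \<in> P \<longleftrightarrow> (j, i) \<in> P"
proof -
  from assms have t: "tree_like_tableau (2 * n + 1) (D, P)" and DP: "D\<inverse> = D" "P\<inverse> = P"
    by (simp_all add: symmetric_tree_like_tableaux_def)
  show f: "ferrers_diagram D" and "P \<subseteq> D" "(0, 0) \<in> P" "\<And>i. i \<in> Domain D \<Longrightarrow> \<exists>j. (i, j) \<in> P"
    using t unfolding tree_like_tableau_def by blast+
  show "(\<forall>i'<i. (i', j) \<notin> P) \<longleftrightarrow> \<not> (\<forall>j'<j. (i, j') \<notin> P)" if "(i, j) \<in> P" "(i, j) \<noteq> (0, 0)" for i j
  proof -
    from t have "\<forall>i j. (i, j) \<in> P \<and> (i, j) \<noteq> (0, 0) \<longrightarrow>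
        ((\<forall>i'<i. (i', j) \<notin> P) \<or> (\<forall>j'<j. (i, j') \<notin> P)) \<and>
        \<not> ((\<forall>i'<i. (i', j) \<notin> P) \<and> (\<forall>j'<j. (i, j') \<notin> P))"
      unfolding tree_like_tableau_def prod.case by (elim conjE)
    then show ?thesis using that by blast
  qed
  show sD: "\<And>i j. (i, j) \<in> D \<longleftrightarrow> (j, i) \<in> D" using DP(1) by blast
  show "\<And>i j. (i, j) \<in> P \<longleftrightarrow> (j, i) \<in> P" using DP(2) by blast
  have RD: "Range D = Domain D" using sD by blast
  have fin: "finite (Domain D)" using f by (simp add: ferrers_diagram_def finite_Domain)
  have "half_perimeter D = 2 * n + 1 + 1" using t unfolding tree_like_tableau_def by blast
  then have "card (Domain D) = Suc n" by (simp add: half_perimeter_def RD)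
  moreover have "y \<in> Domain D" if "x \<in> Domain D" "y \<le> x" for x y
    using that ferrers_diagram_up[OF f] by blast
  ultimately show "Domain D = {..n}" using down_closed_eq_lessThan[OF fin]
    by (simp add: lessThan_Suc_atMost)
  then show "Range D = {..n}" using RD by simp
qed

text \<open>
  A covered point has a point above it, hence nothing to its left in the full tableau; by symmetry the
  left part of row i is column i of the half. Conversely, the leftmost point of row i of the full tableau
  has no point to its left, so that it has a point above it: if it belongs to the half, it is covered.
  Otherwise it lies left of the diagonal, and its mirror image is in column i.
\<close>

lemma fold_tableau_in_half_tableaux:
  assumes "(D, P) \<in> symmetric_tree_like_tableaux (2 * n + 1)"
  shows "fold_tableau (D, P) \<in> half_tableaux n 1 UNIV"
proof -
  note T = symmetric_tableauD[OF assms]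
  note up = ferrers_diagram_up[OF T(1)] and left = ferrers_diagram_left[OF T(1)]
  let ?U = "{(a, b) \<in> D. a \<le> b}" and ?Q = "{(a, b) \<in> P. a < b}"
  have bound: "b \<le> n" if "(a, b) \<in> D" for a b using that T(3) by blast
  have diag: "i = 0" if "(i, i) \<in> P" for i
    using T(7)[OF that] T(9) by blast
  have "half_shape n 1 ?U"
    unfolding half_shape_def
  proof (intro conjI allI impI; (elim conjE)?)
    show "?U \<subseteq> {(a, b). a \<le> b \<and> b \<le> n}" using bound by blast
    show "(a', b) \<in> ?U" if "(a, b) \<in> ?U" "a' \<le> a" for a b a'
      using that up[of a b a'] by simp
    show "(a, b') \<in> ?U" if "(a, b) \<in> ?U" "a \<le> b'" "b' \<le> b" for a b b'
      using that left[of a b b'] by simp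
    obtain i where "(i, n) \<in> D" using T(3) by (metis RangeE atMost_iff order_refl)
    then have "(0, n) \<in> D" using up by blast
    then show "(a, n) \<in> ?U" if "a < 1" for a using that by simp
  qed
  moreover have "half_filling n UNIV ?Q"
    unfolding half_filling_def
  proof (intro conjI ballI)
    show "?Q \<subseteq> {(a, b). a < b \<and> b \<le> n}" using bound T(4) by blast
    fix i assume i: "i \<in> {1..n}"
    have left_empty: "(i, b') \<notin> P" if cov: "covered ?Q i b" and lt: "b' < b" for b b'
    proof -
      obtain a where a: "(i, b) \<in> P" "a < i" "(a, b) \<in> P" using cov unfolding covered_def by blast
      have "(\<forall>i'<i. (i', b) \<notin> P) \<longleftrightarrow> \<not> (\<forall>j'<b. (i, j') \<notin> P)"
        by (rule T(7)[OF a(1)]) (use i in simp)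
      then show ?thesis using a lt by blast
    qed
    have 1: "(i, b') \<notin> ?Q" if "covered ?Q i b" "b' < b" for b b'
      using left_empty[OF that] by simp
    have 2: "(a, i) \<notin> ?Q" if "covered ?Q i b" for a b
    proof
      assume "(a, i) \<in> ?Q"
      then have "(i, a) \<in> P" "a < i" using T(9) by auto
      moreover have "i < b" using that by (auto simp: covered_def)
      ultimately show False using left_empty[OF that, of a] by simp
    qed
    have 3: "\<exists>a. (a, i) \<in> ?Q" if nc: "\<nexists>b. covered ?Q i b"
    proof -
      have ex: "\<exists>j. (i, j) \<in> P" using T(2,6) i by auto
      define j where "j = (LEAST j. (i, j) \<in> P)"
      have j: "(i, j) \<in> P" unfolding j_def using ex by (rule LeastI_ex)
      have least: "(i, j') \<notin> P" if "j' < j" for j' using not_less_Least that unfolding j_def by blast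
      \<comment> \<open>By symmetry a diagonal point has points above it exactly if it has points to its left,
        so that the root is the only pointed diagonal cell.\<close>
      have "j \<noteq> i" using diag j i by auto
      moreover have "\<not> i < j"
      proof
        assume ij: "i < j"
        then have "(i', j) \<notin> P" if "i' < i" for i'
          using nc j that by (auto simp: covered_def)
        then show False using T(7)[OF j] least i by auto
      qed
      ultimately have "(j, i) \<in> ?Q" using j T(9) by auto
      then show ?thesis ..
    qed
    show "if i \<in> UNIV then (\<forall>b b'. covered ?Q i b \<and> b' < b \<longrightarrow> (i, b') \<notin> ?Q) \<and>
                        ((\<exists>a. (a, i) \<in> ?Q) \<longleftrightarrow> \<not> (\<exists>b. covered ?Q i b))
         else (\<forall>b. (i, b) \<notin> ?Q) \<and> (\<forall>a. (a, i) \<notin> ?Q)"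
      using 1 2 3 by (simp del: mem_Collect_eq) blast
  qed
  moreover have "?Q \<subseteq> ?U" using T(4) by auto
  ultimately show ?thesis by (simp add: fold_tableau_def half_tableaux_def)
qed

text \<open>
  The condition on the points has to be checked in the half only, because it is symmetric in rows and
  columns. A point of row 0 always has the root to its left and nothing above it.
\<close>

lemma unfold_tableau_symmetric:
  assumes "(U, Q) \<in> half_tableaux n 1 UNIV"
  shows "unfold_tableau (U, Q) \<in> symmetric_tree_like_tableaux (2 * n + 1)"
proof -
  from assms have S: "half_shape n 1 U" and QU: "Q \<subseteq> U" and F: "half_filling n UNIV Q"
    by (auto simp: half_tableaux_def)
  let ?D = "U \<union> U\<inverse>" and ?P = "insert (0, 0) (Q \<union> Q\<inverse>)"
  have Ub: "a \<le> b" "b \<le> n" if "(a, b) \<in> U" for a b using S that unfolding half_shape_def by blast+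
  have up: "(a', b) \<in> U" if "(a, b) \<in> U" "a' \<le> a" for a b a'
    using S that unfolding half_shape_def by blast
  have left: "(a, b') \<in> U" if "(a, b) \<in> U" "a \<le> b'" "b' \<le> b" for a b b'
    using S that unfolding half_shape_def by blast
  have row0: "(0, b) \<in> U" if "b \<le> n" for b
  proof (rule left)
    show "(0, n) \<in> U" using S unfolding half_shape_def by simp
  qed (use that in auto)
  have Qb: "a < b" "b \<le> n" if "(a, b) \<in> Q" for a b using F that unfolding half_filling_def by blast+
  have fill: "(\<forall>b b'. covered Q i b \<and> b' < b \<longrightarrow> (i, b') \<notin> Q) \<and> ((\<exists>a. (a, i) \<in> Q)
      \<longleftrightarrow> \<not> (\<exists>b. covered Q i b))"
    if "0 < i" "i \<le> n" for i
    using F that unfolding half_filling_def by simp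
  have Dsym: "(i, j) \<in> ?D \<longleftrightarrow> (j, i) \<in> ?D" for i j by auto
  have Psym: "(i, j) \<in> ?P \<longleftrightarrow> (j, i) \<in> ?P" for i j by auto
  have PQ: "(i, j) \<in> ?P \<longleftrightarrow> (i, j) \<in> Q" if "i < j" for i j using that Qb(1)[of j i] by auto
  have Pdiag: "(i, i) \<in> ?P \<longleftrightarrow> i = 0" for i using Qb(1)[of i i] by auto
  have Dleft: "(i, j') \<in> ?D" if ij: "(i, j) \<in> ?D" and j': "j' \<le> j" for i j j'
  proof (cases "(i, j) \<in> U")
    case True
    show ?thesis
    proof (cases "i \<le> j'")
      case True
      then show ?thesis using left[OF \<open>(i, j) \<in> U\<close>] j' by simp
    next
      case False
      have "(i, i) \<in> U" using left[OF True] Ub[OF True] by simp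
      then have "(j', i) \<in> U" by (rule up) (use False in simp)
      then show ?thesis by simp
    qed
  next
    case False
    then have "(j, i) \<in> U" using ij by simp
    then have "(j', i) \<in> U" using j' by (rule up)
    then show ?thesis by simp
  qed
  have Dup: "(i', j) \<in> ?D" if "(i, j) \<in> ?D" "i' \<le> i" for i j i'
    using Dleft[of j i i'] that Dsym by blast
  have finU: "finite U"
  proof (rule finite_subset)
    show "U \<subseteq> {..n} \<times> {..n}"
    proof (rule subrelI)
      fix a b assume "(a, b) \<in> U"
      from Ub[OF this] show "(a, b) \<in> {..n} \<times> {..n}" by simp
    qed
  qed simp
  have fer: "ferrers_diagram ?D"
    unfolding ferrers_diagram_def
  proof (intro conjI allI impI)
    show fD: "finite ?D" using finU by simp
    show "(i, j') \<in> ?D" if "(i, j) \<in> ?D \<and> j' < j" for i j j' using that Dleft[of i j j'] by simp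
    show "card {j. (i', j) \<in> ?D} \<le> card {j. (i, j) \<in> ?D}" if "i \<le> i'" for i i'
    proof (rule card_mono)
      show "finite {j. (i, j) \<in> ?D}" by (rule finite_subset[OF _ finite_Range[OF fD]]) blast
      show "{j. (i', j) \<in> ?D} \<subseteq> {j. (i, j) \<in> ?D}" using Dup that by blast
    qed
  qed
  have dom: "Domain ?D = {..n}" and ran: "Range ?D = {..n}"
  proof -
    have "a \<le> n" if "(a, b) \<in> U" for a b using Ub[OF that] by simp
    then have "Domain ?D \<subseteq> {..n}" using Ub(2) by blast
    moreover have "{..n} \<subseteq> Domain ?D" using row0 by auto
    ultimately show "Domain ?D = {..n}" by (rule subset_antisym)
    then show "Range ?D = {..n}" using Dsym by blast
  qed
  then have per: "half_perimeter ?D = 2 * n + 1 + 1" by (simp add: half_perimeter_def)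
  have sub: "?P \<subseteq> ?D" using QU row0[of 0] by auto
  have rows: "\<exists>j. (i, j) \<in> ?P" if "i \<in> Domain ?D" for i
  proof (cases "i = 0")
    case False
    then have "(\<exists>a. (a, i) \<in> Q) \<or> (\<exists>b. covered Q i b)" using fill[of i] that dom by auto
    then show ?thesis by (auto simp: covered_def)
  qed auto
  have cols: "\<exists>i. (i, j) \<in> ?P" if "j \<in> Range ?D" for j
  proof -
    have "j \<in> Domain ?D" using that by auto
    from rows[OF this] show ?thesis using Psym by blast
  qed
  have one: "(\<forall>i'<i. (i', j) \<notin> ?P) \<longleftrightarrow> \<not> (\<forall>j'<j. (i, j') \<notin> ?P)" if "(i, j) \<in> Q" for i j
  proof (cases "i = 0")
    case True
    then show ?thesis using Qb[OF that] by auto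
  next
    case False
    have ij: "i < j" "i \<le> n" using Qb[OF that] by auto
    have i0: "0 < i" using False by simp
    have cov_left: "(i, b') \<notin> Q" if "covered Q i b" "b' < b" for b b'
      using fill[OF i0 ij(2)] that by blast
    have cov_col: "(\<exists>a. (a, i) \<in> Q) \<longleftrightarrow> \<not> (\<exists>b. covered Q i b)"
      using fill[OF i0 ij(2)] by blast
    have above: "(\<exists>i'<i. (i', j) \<in> ?P) \<longleftrightarrow> covered Q i j"
      using PQ ij that by (auto simp: covered_def dest: Qb)
    show ?thesis
    proof (cases "covered Q i j")
      case True
      have "(i, j') \<notin> ?P" if "j' < j" for j'
      proof (cases i j' rule: linorder_cases)
        case less
        then show ?thesis using PQ[of i j'] cov_left[OF True that] by simp
      next
        case equal
        then show ?thesis using Pdiag[of i] False by simp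
      next
        case greater
        then show ?thesis using PQ[of j' i] Psym[of i j'] cov_col True by blast
      qed
      then show ?thesis using above True by blast
    next
      case nc: False
      have "\<exists>j'<j. (i, j') \<in> ?P"
      proof (cases "\<exists>b. covered Q i b")
        case True
        then obtain b where b: "covered Q i b" by blast
        then have "(i, b) \<in> Q" by (simp add: covered_def)
        moreover have "\<not> j < b" using cov_left[OF b] that by blast
        moreover have "b \<noteq> j" using b nc by auto
        ultimately have "b < j" "(i, b) \<in> ?P" by auto
        then show ?thesis by blast
      next
        case no: False
        then obtain a where a: "(a, i) \<in> Q" using cov_col by blast
        then have "a < j" "(i, a) \<in> ?P" using Qb(1)[OF a] ij by auto
        then show ?thesis by blast
      qed
      then show ?thesis using above nc by blast
    qed
  qed
  have pts: "(\<forall>i'<i. (i', j) \<notin> ?P) \<longleftrightarrow> \<not> (\<forall>j'<j. (i, j') \<notin> ?P)" if "(i, j) \<in> ?P"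
      "(i, j) \<noteq> (0, 0)" for i j
  proof (cases "(i, j) \<in> Q")
    case True
    then show ?thesis by (rule one)
  next
    case False
    then have "(j, i) \<in> Q" using that by auto
    from one[OF this] show ?thesis using Psym by blast
  qed
  have "tree_like_tableau (2 * n + 1) (?D, ?P)"
    unfolding tree_like_tableau_def prod.case
  proof (intro conjI ballI allI impI)
    show "ferrers_diagram ?D" by (rule fer)
    show "half_perimeter ?D = 2 * n + 1 + 1" by (rule per)
    show "?P \<subseteq> ?D" by (rule sub)
    show "(0, 0) \<in> ?P" by simp
    show "\<exists>j. (i, j) \<in> ?P" if "i \<in> Domain ?D" for i by (rule rows[OF that])
    show "\<exists>i. (i, j) \<in> ?P" if "j \<in> Range ?D" for j by (rule cols[OF that])
    fix i j assume ij: "(i, j) \<in> ?P \<and> (i, j) \<noteq> (0, 0)"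
    note p = pts[OF conjunct1[OF ij] conjunct2[OF ij]]
    show "(\<forall>i'<i. (i', j) \<notin> ?P) \<or> (\<forall>j'<j. (i, j') \<notin> ?P)"
      using p by argo
    show "\<not> ((\<forall>i'<i. (i', j) \<notin> ?P) \<and> (\<forall>j'<j. (i, j') \<notin> ?P))"
      using p by argo
  qed
  moreover have "?D\<inverse> = ?D" "?P\<inverse> = ?P" by auto
  ultimately show ?thesis
    unfolding unfold_tableau_def symmetric_tree_like_tableaux_def prod.case mem_Collect_eq
    by (intro conjI)
qed

lemma diag_poly_symmetric_tableaux:
  "diag_poly (symmetric_tree_like_tableaux (2 * n + 1)) = diagonal_poly n"
proof -
  have "diag_poly (symmetric_tree_like_tableaux (2 * n + 1)) = diag_poly (half_tableaux n 1 UNIV)"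
    unfolding diag_poly_def
  proof (rule sum.reindex_bij_witness[where i = unfold_tableau and j = fold_tableau])
    fix T assume "T \<in> symmetric_tree_like_tableaux (2 * n + 1)"
    then obtain D P where T: "T = (D, P)"
        "(D, P) \<in> symmetric_tree_like_tableaux (2 * n + 1)" by (cases T) auto
    note TD = symmetric_tableauD[OF T(2)]
    show "fold_tableau T \<in> half_tableaux n 1 UNIV"
      unfolding T(1) by (rule fold_tableau_in_half_tableaux[OF T(2)])
    have diag: "i = 0" if "(i, i) \<in> P" for i
      using TD(7)[OF that] TD(9) by blast
    have "(a, b) \<in> {(a, b) \<in> D. a \<le> b} \<union> {(a, b) \<in> D. a \<le> b}\<inverse> \<longleftrightarrow> (a, b) \<in> D" for a b
      using TD(8)[of a b] by auto
    moreover have "(a, b) \<in> insert (0, 0) ({(a, b) \<in> P. a < b} \<union> {(a, b) \<in> P. a < b}\<inverse>) \<longleftrightarrow> (a, b) \<in> P"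
      for a b
      using TD(9)[of a b] TD(5) diag[of a] by (cases a b rule: linorder_cases) auto
    ultimately show "unfold_tableau (fold_tableau T) = T"
      unfolding T(1) fold_tableau_def unfold_tableau_def prod.case
      by (simp only: relation_eq_iff prod.inject simp_thms)
    have "{c \<in> {(a, b) \<in> D. a \<le> b}. fst c = snd c} = {c \<in> D. fst c = snd c}" by auto
    then show "monom 1 (diagonal_boxes (fold_tableau T)) = (monom 1 (diagonal_boxes T) :: real poly)"
      by (simp add: T(1) diagonal_boxes_def fold_tableau_def)
  next
    fix T assume "T \<in> half_tableaux n 1 UNIV"
    then obtain U Q where T: "T = (U, Q)" "(U, Q) \<in> half_tableaux n 1 UNIV" by (cases T) auto
    show "unfold_tableau T \<in> symmetric_tree_like_tableaux (2 * n + 1)"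
      unfolding T(1) by (rule unfold_tableau_symmetric[OF T(2)])
    have SF: "half_shape n 1 U" "half_filling n UNIV Q"
      using T(2) by (simp_all add: half_tableaux_def)
    have U: "a \<le> b" if "(a, b) \<in> U" for a b
      using SF(1) that unfolding half_shape_def by blast
    have Q: "a < b" if "(a, b) \<in> Q" for a b
      using SF(2) that unfolding half_filling_def by blast
    have "(a, b) \<in> {(a, b) \<in> U \<union> U\<inverse>. a \<le> b} \<longleftrightarrow> (a, b) \<in> U" for a b
      using U[of a b] U[of b a] by auto
    moreover have "(a, b) \<in> {(a, b) \<in> insert (0, 0) (Q \<union> Q\<inverse>). a < b} \<longleftrightarrow> (a, b) \<in> Q" for a b
      using Q[of a b] Q[of b a] by auto
    ultimately show "fold_tableau (unfold_tableau T) = T"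
      unfolding T(1) fold_tableau_def unfold_tableau_def prod.case
      by (simp only: relation_eq_iff prod.inject simp_thms)
  qed
  also have "\<dots> = monom 1 1 * completion_poly n 0"
    by (subst diag_poly_half_tableaux[where t = n]) auto
  also have "\<dots> = diagonal_poly n"
    by (simp add: diagonal_poly_def completion_poly_def monom_Suc)
  finally show ?thesis .
qed

lemma sum_symmetric_tableaux:
  fixes f :: "nat \<Rightarrow> 'a :: real_field"
  shows "(\<Sum>T\<in>symmetric_tree_like_tableaux (2 * n + 1). f (diagonal_boxes T))
      = (\<Sum>k\<le>Suc n. of_real (diagonal_count n k) * f k)"
proof -
  let ?S = "symmetric_tree_like_tableaux (2 * n + 1)"
  have fin: "finite ?S" by (rule finite_symmetric_tree_like_tableaux)
  have c: "diagonal_count n k = (\<Sum>T\<in>?S. if diagonal_boxes T = k then 1 else 0)" for k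
    unfolding diagonal_count_def diag_poly_symmetric_tableaux[symmetric] diag_poly_def
    by (simp add: coeff_sum coeff_monom)
  have le: "diagonal_boxes T \<le> Suc n" if "T \<in> ?S" for T
  proof (rule ccontr)
    assume "\<not> diagonal_boxes T \<le> Suc n"
    then have "diagonal_count n (diagonal_boxes T) = 0" by (intro diagonal_count_eq_0) simp
    moreover have "diagonal_count n (diagonal_boxes T)
        = real (card {T' \<in> ?S. diagonal_boxes T' = diagonal_boxes T})"
      unfolding c using fin by (simp add: sum.If_cases Int_def)
    ultimately have "card {T' \<in> ?S. diagonal_boxes T' = diagonal_boxes T} = 0" by simp
    moreover have "finite {T' \<in> ?S. diagonal_boxes T' = diagonal_boxes T}" using fin by simp
    ultimately have "{T' \<in> ?S. diagonal_boxes T' = diagonal_boxes T} = {}" by simp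
    then show False using that by blast
  qed
  have "(\<Sum>k\<le>Suc n. of_real (diagonal_count n k) * f k)
      = (\<Sum>k\<le>Suc n. \<Sum>T\<in>?S. if diagonal_boxes T = k then f k else 0)"
    unfolding c by (intro sum.cong refl) (simp add: sum_distrib_right if_distrib[of of_real] if_distrib[of "\<lambda>x. x * _"] cong: if_cong)
  also have "\<dots> = (\<Sum>T\<in>?S. \<Sum>k\<le>Suc n. if diagonal_boxes T = k then f k else 0)"
    by (rule sum.swap)
  also have "\<dots> = (\<Sum>T\<in>?S. f (diagonal_boxes T))"
    by (intro sum.cong refl) (use le in \<open>simp del: sum.atMost_Suc\<close>)
  finally show ?thesis by simp
qed

section \<open>The Markov chain of diagonal boxes\<close>

lemma diagonal_count_nonneg: "diagonal_count n k \<ge> 0"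
proof (induction n arbitrary: k)
  case 0
  show ?case by (simp add: diagonal_count_0)
next
  case (Suc n)
  have "(real n + 3 - real k) * diagonal_count n (k - 2) \<ge> 0" if "k \<ge> 2"
    using Suc.IH[of "k - 2"] diagonal_count_eq_0[of n "k - 2"] that by (cases "k \<le> n + 3") auto
  then show ?case unfolding diagonal_count_Suc using Suc.IH by auto
qed

text \<open>
  The mean of \<open>f\<close> at the number of diagonal boxes over all symmetric tableaux of size 2n + 1, of which
  there are 2^n n!.
\<close>

definition average :: "nat \<Rightarrow> (nat \<Rightarrow> 'a :: real_field) \<Rightarrow> 'a" where
  "average n f = (\<Sum>k\<le>Suc n. of_real (diagonal_count n k) * f k) / (2 ^ n * fact n)"

lemma average_cong: "(\<And>k. k \<le> Suc n \<Longrightarrow> f k = g k) \<Longrightarrow> average n f = average n g"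
  by (simp add: average_def)

lemma average_0: "average 0 f = f 1" by (simp add: average_def diagonal_count_0)

text \<open>
  The transition law of the Markov chain of diagonal boxes.
\<close>

lemma average_Suc: "average (Suc n) f = average n (\<lambda>k. (of_nat k * f k + of_nat (Suc n) * f (Suc k)
   + (of_nat (Suc n) - of_nat k) * f (Suc (Suc k))) / (2 * of_nat (Suc n)))"
  unfolding average_def sum_diagonal_count_Suc
  by (simp add: sum_divide_distrib[symmetric] mult_ac del: of_nat_Suc sum.atMost_Suc)

lemma average_add: "average n (\<lambda>k. f k + g k) = average n f + average n g"
  by (simp add: average_def sum.distrib distrib_left add_divide_distrib)

lemma average_diff: "average n (\<lambda>k. f k - g k) = average n f - average n g"
  by (simp add: average_def sum_subtractf right_diff_distrib diff_divide_distrib)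

lemma average_mult: "average n (\<lambda>k. a * f k) = a * average n f"
  by (simp add: average_def sum_distrib_left mult_ac distrib_left)

lemma average_1: "average n (\<lambda>_. 1) = 1"
proof (induction n)
  case (Suc n)
  have "(of_nat k + of_nat (Suc n) + (of_nat (Suc n) - of_nat k)) / (2 * of_nat (Suc n)) = (1 :: 'a)"
    for k
    by (simp add: field_simps del: of_nat_Suc)
  then show ?case unfolding average_Suc using Suc by simp
qed (simp add: average_0)

lemma average_const: "average n (\<lambda>_. a) = a"
  using average_mult[of n a "\<lambda>_. 1"] by (simp add: average_1)

lemma average_mono: fixes f g :: "nat \<Rightarrow> real"
  shows "(\<And>k. k \<le> Suc n \<Longrightarrow> f k \<le> g k) \<Longrightarrow> average n f \<le> average n g"
  unfolding average_def
  by (intro divide_right_mono sum_mono mult_left_mono) (auto simp: diagonal_count_nonneg)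

lemma norm_average_le: "cmod (average n f) \<le> average n (\<lambda>k. cmod (f k))"
proof -
  have "cmod (2 ^ n * fact n) = 2 ^ n * fact n" by (simp add: norm_mult norm_power)
  moreover have "cmod (\<Sum>k\<le>Suc n. of_real (diagonal_count n k) * f k)
      \<le> (\<Sum>k\<le>Suc n. of_real (diagonal_count n k) * cmod (f k))"
    by (rule order_trans[OF norm_sum]) (simp add: norm_mult diagonal_count_nonneg)
  ultimately show ?thesis unfolding average_def norm_divide by (simp add: divide_right_mono)
qed

definition deviation :: "nat \<Rightarrow> nat \<Rightarrow> real" where "deviation n k = real k - 3 * (real n + 1) / 4"

text \<open>
  The conditional mean of the deviation at time m is (1 - 1/m) times the deviation before. The mean
  deviation is 1/4 for n = 0 and therefore 0 later on; the bound covers both cases.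
\<close>

lemma average_deviation_nonneg: "average n (deviation n) \<ge> 0"
proof (induction n)
  case 0
  show ?case by (simp add: average_0 deviation_def)
next
  case (Suc n)
  have "average (Suc n) (deviation (Suc n)) = average n (\<lambda>k. (1 - 1 / real (Suc n)) * deviation n k)"
    unfolding average_Suc by (rule average_cong) (simp add: deviation_def field_simps)
  then show ?case using Suc by (simp add: average_mult)
qed

text \<open>
  With y the deviation before time m, the conditional second moment afterwards is
  (1 - 2/m) y^2 + 7/16 - y/(2m), so that the mean square grows by at most 7/16 per step.
\<close>

lemma average_deviation_square_le: "average n (\<lambda>k. (deviation n k)\<^sup>2) \<le> real (Suc n)"
proof (induction n)
  case 0
  show ?case by (simp add: average_0 deviation_def power2_eq_square)
next
  case (Suc n)
  define m where "m = real (Suc n)"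
  have m: "m \<ge> 1" by (simp add: m_def)
  have "average (Suc n) (\<lambda>k. (deviation (Suc n) k)\<^sup>2)
      = average n (\<lambda>k. (1 - 2 / m) * (deviation n k)\<^sup>2 + 7 / 16 - deviation n k / (2 * m))"
    unfolding average_Suc of_nat_id m_def[symmetric]
  proof (rule average_cong)
    fix k
    define z where "z = deviation n k"
    have k: "real k = z + 3 * m / 4" by (simp add: z_def deviation_def m_def)
    have y: "deviation (Suc n) k = z - 3 / 4" "deviation (Suc n) (Suc k) = z + 1 / 4"
        "deviation (Suc n) (Suc (Suc k)) = z + 5 / 4"
      by (simp_all add: z_def deviation_def field_simps)
    show "(real k * (deviation (Suc n) k)\<^sup>2 + m * (deviation (Suc n) (Suc k))\<^sup>2
        + (m - real k) * (deviation (Suc n) (Suc (Suc k)))\<^sup>2) / (2 * m)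
        = (1 - 2 / m) * (deviation n k)\<^sup>2 + 7 / 16 - deviation n k / (2 * m)"
      unfolding y z_def[symmetric] unfolding k using m by (simp add: field_simps power2_eq_square)
  qed
  also have "\<dots> \<le> average n (\<lambda>k. (deviation n k)\<^sup>2 + 7 / 16 + (- 1 / (2 * m)) * deviation n k)"
  proof (rule average_mono)
    fix k
    have "(1 - 2 / m) * (deviation n k)\<^sup>2 \<le> 1 * (deviation n k)\<^sup>2" using m
      by (intro mult_right_mono) auto
    then show "(1 - 2 / m) * (deviation n k)\<^sup>2 + 7 / 16 - deviation n k / (2 * m)
        \<le> (deviation n k)\<^sup>2 + 7 / 16 + (- 1 / (2 * m)) * deviation n k"
      by simp
  qed
  also have "\<dots> = average n (\<lambda>k. (deviation n k)\<^sup>2) + 7 / 16 - average n (deviation n) / (2 * m)"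
    by (simp only: average_add average_mult average_const) simp
  also have "\<dots> \<le> real (Suc n) + 7 / 16 - 0"
    by (intro diff_mono add_mono Suc divide_nonneg_nonneg average_deviation_nonneg order_refl)
        (use m in simp)
  finally show ?case by simp
qed

lemma average_abs_deviation_le: "average n (\<lambda>k. \<bar>deviation n k\<bar>) \<le> sqrt (real (Suc n))"
proof -
  define a where "a = sqrt (real (Suc n))"
  have a: "a > 0" "a * a = real (Suc n)" by (simp_all add: a_def)
  have "average n (\<lambda>k. \<bar>deviation n k\<bar>) \<le> average n (\<lambda>k. (1 / (2 * a)) * (deviation n k)\<^sup>2 + a / 2)"
  proof (rule average_mono)
    fix k
    \<comment> \<open>For a = sqrt (n + 1) both terms of |z| \<le> z^2 / (2 a) + a / 2 have a mean of at most a / 2.\<close>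
    have "0 \<le> (\<bar>deviation n k\<bar> - a)\<^sup>2" by simp
    then have "2 * a * \<bar>deviation n k\<bar> \<le> (deviation n k)\<^sup>2 + a\<^sup>2" by (simp add: power2_diff mult_ac)
    then show "\<bar>deviation n k\<bar> \<le> (1 / (2 * a)) * (deviation n k)\<^sup>2 + a / 2"
      using a by (simp add: field_simps power2_eq_square)
  qed
  also have "\<dots> = (1 / (2 * a)) * average n (\<lambda>k. (deviation n k)\<^sup>2) + a / 2"
    by (simp only: average_add average_mult average_const)
  also have "\<dots> \<le> (1 / (2 * a)) * (a * a) + a / 2"
    unfolding a(2) using a(1) by (intro add_mono mult_left_mono average_deviation_square_le) auto
  also have "\<dots> = a" using a(1) by simp
  finally show ?thesis by (simp add: a_def)
qed

section \<open>Characteristic functions of the martingale\<close>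

text \<open>
  The characteristic function of the martingale n Y, where Y is the deviation at time n.
\<close>

definition scaled_char :: "nat \<Rightarrow> real \<Rightarrow> complex" where
  "scaled_char n s = average n (\<lambda>k. iexp (s * (real n * deviation n k)))"

lemma iexp_quadratic: "cmod (iexp x - (1 + \<i> * x - of_real (x\<^sup>2 / 2))) \<le> \<bar>x\<bar> ^ 3 / 6"
  using iexp_approx1[of x 2] by (simp add: eval_nat_numeral algebra_simps power_mult_distrib)

text \<open>
  The characteristic function of one centred increment of the chain, where y is the relative deviation
  k/m - 3/4. The increments 0, 1, 2 minus their mean 3/4 - y are y - 3/4, y + 1/4
      and y + 5/4; they have
  the probabilities (y + 3/4)/2, 1/2 and (1/4 - y)/2, hence the variance 7/16 - y/2 - y^2. The linear
  Taylor terms cancel, and replacing the variance by 7/16 costs the second error term.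
\<close>

lemma step_estimate:
  fixes s y :: real
  assumes y: "- 3 / 4 \<le> y" "y \<le> 1 / 4"
  shows "cmod ((of_real (y + 3/4) * iexp (s * (y - 3/4)) + iexp (s * (y + 1/4))
      + of_real (1/4 - y) * iexp (s * (y + 5/4))) / 2 - of_real (1 - 7 / 32 * s\<^sup>2))
    \<le> 2 * \<bar>s\<bar> ^ 3 + s\<^sup>2 * \<bar>y\<bar>" (is "cmod (?A - _) \<le> _")
proof -
  define q :: "real \<Rightarrow> complex" where "q x = 1 + \<i> * x - of_real (x\<^sup>2 / 2)" for x
  define r where "r x = iexp x - q x" for x
  have r: "cmod (r (s * d)) \<le> 2 * \<bar>s\<bar> ^ 3" if "\<bar>d\<bar> \<le> 2" for d
  proof -
    have "cmod (r (s * d)) \<le> (\<bar>s\<bar> * \<bar>d\<bar>) ^ 3 / 6"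
      using iexp_quadratic[of "s * d"] unfolding r_def q_def by (simp add: abs_mult)
    also have "\<dots> \<le> (\<bar>s\<bar> * 2) ^ 3 / 6"
      by (intro divide_right_mono power_mono mult_left_mono) (use that in auto)
    also have "\<dots> \<le> 2 * \<bar>s\<bar> ^ 3" by (simp add: power_mult_distrib)
    finally show ?thesis .
  qed
  have e: "iexp x = q x + r x" for x by (simp add: r_def)
  have q: "(of_real (y + 3/4) * q (s * (y - 3/4)) + q (s * (y + 1/4))
      + of_real (1/4 - y) * q (s * (y + 5/4))) / 2
      = of_real (1 - 7 / 32 * s\<^sup>2 + s\<^sup>2 * (y / 4 + y\<^sup>2 / 2))"
    unfolding q_def by (simp add: complex_eq_iff) (simp add: field_simps power2_eq_square)
  define R where "R = (of_real (y + 3/4) * r (s * (y - 3/4)) + r (s * (y + 1/4))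
      + of_real (1/4 - y) * r (s * (y + 5/4))) / 2"
  have "?A - of_real (1 - 7 / 32 * s\<^sup>2)
      = (of_real (y + 3/4) * q (s * (y - 3/4)) + q (s * (y + 1/4)) + of_real (1/4 - y) * q (s * (y + 5/4))) / 2
     - of_real (1 - 7 / 32 * s\<^sup>2) + R"
    unfolding e R_def by (simp add: field_simps)
  then have "?A - of_real (1 - 7 / 32 * s\<^sup>2) = of_real (s\<^sup>2 * (y / 4 + y\<^sup>2 / 2)) + R"
    unfolding q by simp
  then have "cmod (?A - of_real (1 - 7 / 32 * s\<^sup>2)) = cmod (of_real (s\<^sup>2 * (y / 4 + y\<^sup>2 / 2)) + R)"
    by (rule arg_cong)
  also have "\<dots> \<le> s\<^sup>2 * \<bar>y / 4 + y\<^sup>2 / 2\<bar>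
      + ((y + 3/4) * (2 * \<bar>s\<bar> ^ 3) + 2 * \<bar>s\<bar> ^ 3 + (1/4 - y) * (2 * \<bar>s\<bar> ^ 3)) / 2"
  proof (rule order_trans[OF norm_triangle_ineq add_mono])
    show "cmod (of_real (s\<^sup>2 * (y / 4 + y\<^sup>2 / 2))) \<le> s\<^sup>2 * \<bar>y / 4 + y\<^sup>2 / 2\<bar>"
      unfolding norm_of_real by (simp add: abs_mult)
    have n: "cmod (of_real a * r (s * d)) \<le> a * (2 * \<bar>s\<bar> ^ 3)" if "a \<ge> 0" "\<bar>d\<bar> \<le> 2" for a d
      unfolding norm_mult norm_of_real using that r[of d] by (simp add: mult_left_mono)
    have y1: "\<bar>y + 1/4\<bar> \<le> 2" using y by simp
    show "cmod R
      \<le> ((y + 3/4) * (2 * \<bar>s\<bar> ^ 3) + 2 * \<bar>s\<bar> ^ 3 + (1/4 - y) * (2 * \<bar>s\<bar> ^ 3)) / 2"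
      unfolding norm_divide R_def
      using norm_triangle_ineq[of "of_real (y + 3/4) * r (s * (y - 3/4)) + r (s * (y + 1/4))"
          "of_real (1/4 - y) * r (s * (y + 5/4))"]
        norm_triangle_ineq[of "of_real (y + 3/4) * r (s * (y - 3/4))" "r (s * (y + 1/4))"]
        n[of "y + 3/4" "y - 3/4"] n[of "1/4 - y" "y + 5/4"] r[of "y + 1/4", OF y1] y
      by simp
  qed
  also have "\<dots> = 2 * \<bar>s\<bar> ^ 3 + s\<^sup>2 * \<bar>y / 4 + y\<^sup>2 / 2\<bar>"
  proof -
    have "((y + 3/4) * d + d + (1/4 - y) * d) / 2 = d" for d :: real by (simp add: ring_distribs)
    then show ?thesis by simp
  qed
  also have "\<dots> \<le> 2 * \<bar>s\<bar> ^ 3 + s\<^sup>2 * \<bar>y\<bar>"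
  proof (intro add_mono mult_left_mono order_refl)
    have "y / 4 + y\<^sup>2 / 2 = y * (1 / 4 + y / 2)" by (simp add: field_simps power2_eq_square)
    moreover have "\<bar>y * (1 / 4 + y / 2)\<bar> \<le> \<bar>y\<bar> * 1"
      unfolding abs_mult using y by (intro mult_left_mono) auto
    ultimately show "\<bar>y / 4 + y\<^sup>2 / 2\<bar> \<le> \<bar>y\<bar>" by simp
  qed simp_all
  finally show ?thesis .
qed

text \<open>
  The value of m times the new deviation is n times the old deviation plus m times the centred
  increment, because the conditional mean of the increment is 3/4 minus the old deviation divided by m.
  Averaging the error of the one-step estimate leaves the mean absolute deviation, at most sqrt m.
\<close>

lemma scaled_char_step:
  fixes s :: real and n :: nat
  defines "m \<equiv> real (Suc n)"
  shows "cmod (scaled_char (Suc n) s - of_real (1 - 7 / 32 * (s * m)\<^sup>2) * scaled_char n s)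
      \<le> 2 * (\<bar>s\<bar> * m) ^ 3 + s\<^sup>2 * m * sqrt m"
proof -
  define A :: "nat \<Rightarrow> complex" where "A k = (let y = deviation n k / m in
     (of_real (y + 3/4) * iexp (s * m * (y - 3/4)) + iexp (s * m * (y + 1/4))
      + of_real (1/4 - y) * iexp (s * m * (y + 5/4))) / 2)" for k
  have m: "m \<ge> 1" by (simp add: m_def)
  have "scaled_char (Suc n) s = average n (\<lambda>k. iexp (s * (real n * deviation n k)) * A k)"
    unfolding scaled_char_def average_Suc
  proof (rule average_cong)
    fix k
    define y where "y = deviation n k / m"
    have dev: "deviation n k = y * m" using m by (simp add: y_def)
    have k: "real k = m * (y + 3/4)" using m by (simp add: y_def deviation_def m_def field_simps)
    have mk: "of_nat (Suc n) - of_nat k = (of_real (m * (1 / 4 - y)) :: complex)"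
    proof -
      have "real (Suc n) - real k = m * (1 / 4 - y)" unfolding k by (simp add: m_def field_simps)
      then show ?thesis by (metis of_real_diff of_real_of_nat_eq)
    qed
    have kc: "of_nat k = (of_real (m * (y + 3/4)) :: complex)" by (metis k of_real_of_nat_eq)
    have mc: "of_nat (Suc n) = (of_real m :: complex)" unfolding m_def by simp
    have n: "real n = m - 1" by (simp add: m_def)
    have e: "iexp (s * (real (Suc n) * deviation (Suc n) k))
        = iexp (s * (real n * deviation n k)) * iexp (s * m * (y - 3/4))"
         "iexp (s * (real (Suc n) * deviation (Suc n) (Suc k)))
             = iexp (s * (real n * deviation n k)) * iexp (s * m * (y + 1/4))"
         "iexp (s * (real (Suc n) * deviation (Suc n) (Suc (Suc k))))
             = iexp (s * (real n * deviation n k)) * iexp (s * m * (y + 5/4))"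
    proof -
      have *: "deviation (Suc n) k = y * m - 3 / 4" "deviation (Suc n) (Suc k) = y * m + 1 / 4"
          "deviation (Suc n) (Suc (Suc k)) = y * m + 5 / 4"
        unfolding dev[symmetric] by (simp_all add: deviation_def field_simps)
      have **: "s * (m * (y * m + d)) = s * (real n * deviation n k) + s * m * (y + d)" for d
        unfolding n dev by (simp add: algebra_simps)
      show "iexp (s * (real (Suc n) * deviation (Suc n) k))
          = iexp (s * (real n * deviation n k)) * iexp (s * m * (y - 3/4))"
         "iexp (s * (real (Suc n) * deviation (Suc n) (Suc k)))
             = iexp (s * (real n * deviation n k)) * iexp (s * m * (y + 1/4))"
         "iexp (s * (real (Suc n) * deviation (Suc n) (Suc (Suc k))))
             = iexp (s * (real n * deviation n k)) * iexp (s * m * (y + 5/4))"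
        unfolding m_def[symmetric] exp_add[symmetric] distrib_left[symmetric] of_real_add[symmetric] *
        using **[of "-3/4"] **[of "1/4"] **[of "5/4"] by simp_all
    qed
    show "(of_nat k * iexp (s * (real (Suc n) * deviation (Suc n) k)) +
          of_nat (Suc n) * iexp (s * (real (Suc n) * deviation (Suc n) (Suc k))) +
          (of_nat (Suc n) - of_nat k) * iexp (s * (real (Suc n) * deviation (Suc n) (Suc (Suc k))))) /
         (2 * of_nat (Suc n)) = iexp (s * (real n * deviation n k)) * A k"
      unfolding e mk kc mc A_def Let_def y_def[symmetric] using m by (simp add: field_simps)
  qed
  then have "scaled_char (Suc n) s - of_real (1 - 7 / 32 * (s * m)\<^sup>2) * scaled_char n s
      = average n (\<lambda>k. iexp (s * (real n * deviation n k)) * A k - of_real (1 - 7 / 32 * (s * m)\<^sup>2) * iexp (s * (real n * deviation n k)))"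
    by (simp only: scaled_char_def[of n] average_mult average_diff)
  also have "\<dots> = average n (\<lambda>k. iexp (s * (real n * deviation n k))
      * (A k - of_real (1 - 7 / 32 * (s * m)\<^sup>2)))"
    by (rule average_cong) (simp add: algebra_simps)
  also have "cmod \<dots> \<le> average n (\<lambda>k. cmod (iexp (s * (real n * deviation n k))
      * (A k - of_real (1 - 7 / 32 * (s * m)\<^sup>2))))"
    by (rule norm_average_le)
  also have "\<dots> \<le> average n (\<lambda>k. 2 * (\<bar>s\<bar> * m) ^ 3 + s\<^sup>2 * m * \<bar>deviation n k\<bar>)"
  proof (rule average_mono)
    fix k assume k: "k \<le> Suc n"
    have y: "-3 / 4 \<le> deviation n k / m" "deviation n k / m \<le> 1 / 4"
      using k m by (auto simp: deviation_def m_def field_simps)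
    have "cmod (A k - of_real (1 - 7 / 32 * (s * m)\<^sup>2))
        \<le> 2 * \<bar>s * m\<bar> ^ 3 + (s * m)\<^sup>2 * \<bar>deviation n k / m\<bar>"
      unfolding A_def Let_def by (rule step_estimate[OF y])
    also have "\<dots> = 2 * (\<bar>s\<bar> * m) ^ 3 + s\<^sup>2 * m * \<bar>deviation n k\<bar>"
      using m by (simp add: abs_mult field_simps power2_eq_square)
    finally show "cmod (iexp (s * (real n * deviation n k)) * (A k - of_real (1 - 7 / 32 * (s * m)\<^sup>2)))
       \<le> 2 * (\<bar>s\<bar> * m) ^ 3 + s\<^sup>2 * m * \<bar>deviation n k\<bar>"
      by (simp add: norm_mult)
  qed
  also have "\<dots> = 2 * (\<bar>s\<bar> * m) ^ 3 + s\<^sup>2 * m * average n (\<lambda>k. \<bar>deviation n k\<bar>)"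
    by (simp only: average_add average_mult average_const)
  also have "\<dots> \<le> 2 * (\<bar>s\<bar> * m) ^ 3 + s\<^sup>2 * m * sqrt m"
    unfolding m_def by (intro add_mono mult_left_mono order_refl average_abs_deviation_le) simp
  finally show ?thesis .
qed

text \<open>
  The upper bound holds because (1 - x + x^2/2) (1 + x + x^2/2) = 1 + x^4/4 is at least 1.
\<close>

lemma exp_minus_approx: fixes x :: real assumes "x \<ge> 0"
  shows "\<bar>exp (- x) - (1 - x)\<bar> \<le> x\<^sup>2 / 2"
proof -
  have "exp (- x) \<le> 1 / (1 + x + x\<^sup>2 / 2)"
    unfolding exp_minus inverse_eq_divide using exp_lower_Taylor_quadratic[OF assms] assms
    by (intro divide_left_mono mult_pos_pos) (auto intro: add_pos_nonneg)
  also have "\<dots> \<le> 1 - x + x\<^sup>2 / 2"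
  proof -
    have "(1 - x + x\<^sup>2 / 2) * (1 + x + x\<^sup>2 / 2) = 1 + (x\<^sup>2 / 2)\<^sup>2"
      by (simp add: algebra_simps power2_eq_square)
    then have "(1 - x + x\<^sup>2 / 2) * (1 + x + x\<^sup>2 / 2) \<ge> 1"
      by simp
    moreover have "1 + x + x\<^sup>2 / 2 > 0" using assms by (simp add: add_pos_nonneg)
    ultimately show ?thesis by (simp add: divide_le_eq)
  qed
  finally show ?thesis using exp_ge_add_one_self[of "-x"] by simp
qed

lemma norm_scaled_char_le: "cmod (scaled_char n s) \<le> 1"
  unfolding scaled_char_def by (rule order_trans[OF norm_average_le]) (simp add: average_1)

text \<open>
  Telescoping: the one-step errors add up, since all factors exp (- 7 s^2 m^2 / 32) are at most 1. The
  term with s^4 is the cost of replacing 1 - q by exp (- q).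
\<close>

lemma scaled_char_approx:
  assumes "n \<le> N"
  shows "cmod (scaled_char n s - of_real (exp (- (7 / 32 * s\<^sup>2 * (\<Sum>i\<le>n. (real i)\<^sup>2)))))
    \<le> real n * (2 * (\<bar>s\<bar> * real N) ^ 3 + s\<^sup>2 * real N * sqrt (real N) + s ^ 4 * real N ^ 4)"
  using assms
proof (induction n)
  case 0
  show ?case by (simp add: scaled_char_def average_1)
next
  case (Suc n)
  define m where "m = real (Suc n)"
  define q where "q = 7 / 32 * (s * m)\<^sup>2"
  let ?e = "\<lambda>n. exp (- (7 / 32 * s\<^sup>2 * (\<Sum>i\<le>n. (real i)\<^sup>2)))"
  have m: "1 \<le> m" "m \<le> real N" using Suc.prems by (simp_all add: m_def)
  have q0: "q \<ge> 0" by (simp add: q_def)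
  have e: "?e (Suc n) = exp (- q) * ?e n"
    unfolding exp_add[symmetric]
    by (simp add: q_def m_def power_mult_distrib distrib_left del: of_nat_Suc)
  have "scaled_char (Suc n) s - of_real (?e (Suc n))
      = (scaled_char (Suc n) s - of_real (1 - q) * scaled_char n s)
     + (of_real (exp (- q)) * (scaled_char n s - of_real (?e n))) + of_real (1 - q - exp (- q)) * scaled_char n s"
    unfolding e by (simp add: algebra_simps)
  also have "cmod \<dots> \<le> (2 * (\<bar>s\<bar> * m) ^ 3 + s\<^sup>2 * m * sqrt m)
      + 1 * cmod (scaled_char n s - of_real (?e n)) + (q\<^sup>2 / 2) * 1"
  proof (intro order_trans[OF norm_triangle_ineq add_mono] order_trans[OF norm_triangle_ineq add_mono])
    show "cmod (scaled_char (Suc n) s - of_real (1 - q) * scaled_char n s)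
        \<le> 2 * (\<bar>s\<bar> * m) ^ 3 + s\<^sup>2 * m * sqrt m"
      unfolding q_def m_def by (rule scaled_char_step)
    show "cmod (of_real (exp (- q)) * (scaled_char n s - of_real (?e n)))
        \<le> 1 * cmod (scaled_char n s - of_real (?e n))"
      unfolding norm_mult norm_of_real by (intro mult_right_mono) (use q0 in auto)
    show "cmod (of_real (1 - q - exp (- q)) * scaled_char n s) \<le> (q\<^sup>2 / 2) * 1"
      unfolding norm_mult norm_of_real
      using exp_minus_approx[OF q0] norm_scaled_char_le[of n s] abs_minus_commute[of "exp (- q)"
      "1 - q"]
      by (intro mult_mono) auto
  qed
  also have "\<dots> \<le> (2 * (\<bar>s\<bar> * real N) ^ 3 + s\<^sup>2 * real N * sqrt (real N))
      + 1 * cmod (scaled_char n s - of_real (?e n)) + s ^ 4 * real N ^ 4"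
  proof (intro add_mono order_refl)
    show "2 * (\<bar>s\<bar> * m) ^ 3 \<le> 2 * (\<bar>s\<bar> * real N) ^ 3"
      by (intro mult_left_mono power_mono) (use m in auto)
    show "s\<^sup>2 * m * sqrt m \<le> s\<^sup>2 * real N * sqrt (real N)"
      by (intro mult_mono order_refl real_sqrt_le_mono) (use m in auto)
    have "q\<^sup>2 / 2 * 1 = (7/32)\<^sup>2 / 2 * (s ^ 4 * m ^ 4)"
      by (simp add: q_def power2_eq_square power4_eq_xxxx)
    also have "\<dots> \<le> 1 * (s ^ 4 * real N ^ 4)"
      by (intro mult_mono power_mono order_refl) (use m in \<open>auto simp: power2_eq_square\<close>)
    finally show "q\<^sup>2 / 2 * 1 \<le> s ^ 4 * real N ^ 4" by simp
  qed
  also have "\<dots> \<le> real (Suc n) * (2 * (\<bar>s\<bar> * real N) ^ 3 + s\<^sup>2 * real N * sqrt (real N)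
      + s ^ 4 * real N ^ 4)"
    using Suc by (simp add: algebra_simps)
  finally show ?case .
qed

text \<open>
  At this argument the martingale is divided
    by n times the standard deviation sqrt (7 (n + 1) / 48). It
  is of order n^(-3/2), so that the three errors in \<open>scaled_char_approx\<close> are of order n^(-1/2), n^(-1/2)
  and n^(-1), while the exponent is t^2 (2n + 1) / (4n).
\<close>

lemma scaled_char_tendsto:
  "(\<lambda>n. scaled_char n (t / (real n * sqrt (7 * (real n + 1) / 48)))) \<longlonglongrightarrow> of_real (exp (- t\<^sup>2 / 2))"
proof -
  define s where "s n = t / (real n * sqrt (7 * (real n + 1) / 48))" for n
  define e where "e n = exp (- (7 / 32 * (s n)\<^sup>2 * (\<Sum>i\<le>n. (real i)\<^sup>2)))" for n
  have sq: "(\<Sum>i\<le>n. (real i)\<^sup>2) = real n * (real n + 1) * (2 * real n + 1) / 6" for n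
    by (induction n) (simp_all add: field_simps power2_eq_square)
  have "(\<lambda>n. e n) \<longlonglongrightarrow> exp (- t\<^sup>2 / 2)"
  proof -
    have "(\<lambda>n. exp (- (t\<^sup>2 / 4 * ((2 * real n + 1) / real n)))) \<longlonglongrightarrow> exp (- (t\<^sup>2 / 4 * 2))"
      by (intro tendsto_intros) real_asymp
    moreover have "\<forall>\<^sub>F n in sequentially. exp (- (t\<^sup>2 / 4 * ((2 * real n + 1) / real n))) = e n"
      using eventually_gt_at_top[of 0]
    proof eventually_elim
      case (elim n)
      have "7 / 32 * (s n)\<^sup>2 * (real n * (real n + 1) * (2 * real n + 1) / 6)
          = t\<^sup>2 / 4 * ((2 * real n + 1) / real n)"
      proof -
        define b where "b = real n + 1"
        have "b > 0" by (simp add: b_def)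
        define a where "a = real n"
        have "a > 0" using elim by (simp add: a_def)
        have s2: "(s n)\<^sup>2 = t\<^sup>2 / (a\<^sup>2 * (7 * b / 48))"
          using \<open>b > 0\<close> unfolding s_def b_def[symmetric]
          unfolding a_def[symmetric] power_divide power_mult_distrib by simp
        then show ?thesis
          using \<open>a > 0\<close> \<open>b > 0\<close> unfolding b_def[symmetric] s2 unfolding a_def[symmetric]
          by (simp add: divide_simps power2_eq_square)
      qed
      then show ?case unfolding e_def sq by simp
    qed
    ultimately show ?thesis by (simp add: tendsto_cong)
  qed
  then have 1: "(\<lambda>n. of_real (e n) :: complex) \<longlonglongrightarrow> of_real (exp (- t\<^sup>2 / 2))" by (rule tendsto_of_real)
  have "(\<lambda>n. scaled_char n (s n) - of_real (e n)) \<longlonglongrightarrow> 0"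
  proof (rule Lim_null_comparison)
    let ?r = "\<lambda>n. 1 / (real n * sqrt (7 * (real n + 1) / 48))"
    show "\<forall>\<^sub>F n in sequentially. norm (scaled_char n (s n) - of_real (e n))
      \<le> 2 * \<bar>t\<bar> ^ 3 * (real n * (?r n * real n) ^ 3) + t\<^sup>2 * (real n * ((?r n)\<^sup>2 * real n * sqrt (real n))) + t ^ 4 * (real n * ((?r n) ^ 4 * real n ^ 4))"
    proof (rule always_eventually, rule allI)
      fix n
      have st: "s n = t * ?r n" by (simp add: s_def)
      have r: "\<bar>s n\<bar> = \<bar>t\<bar> * ?r n" unfolding st abs_mult by simp
      have "real n * (2 * (\<bar>s n\<bar> * real n) ^ 3 + (s n)\<^sup>2 * real n * sqrt (real n)
          + s n ^ 4 * real n ^ 4)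
         = 2 * \<bar>t\<bar> ^ 3 * (real n * (?r n * real n) ^ 3) + t\<^sup>2 * (real n * ((?r n)\<^sup>2 * real n * sqrt (real n))) + t ^ 4 * (real n * ((?r n) ^ 4 * real n ^ 4))"
        unfolding r unfolding st power_mult_distrib by (simp only: algebra_simps)
      then show "norm (scaled_char n (s n) - of_real (e n))
      \<le> 2 * \<bar>t\<bar> ^ 3 * (real n * (?r n * real n) ^ 3) + t\<^sup>2 * (real n * ((?r n)\<^sup>2 * real n * sqrt (real n))) + t ^ 4 * (real n * ((?r n) ^ 4 * real n ^ 4))"
        using scaled_char_approx[of n n "s n"] unfolding e_def by simp
    qed
    have a: "(\<lambda>n. real n * (?r n * real n) ^ 3) \<longlonglongrightarrow> 0" by real_asymp
    have b: "(\<lambda>n. real n * ((?r n)\<^sup>2 * real n * sqrt (real n))) \<longlonglongrightarrow> 0" by real_asymp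
    have c: "(\<lambda>n. real n * ((?r n) ^ 4 * real n ^ 4)) \<longlonglongrightarrow> 0" by real_asymp
    show "(\<lambda>n. 2 * \<bar>t\<bar> ^ 3 * (real n * (?r n * real n) ^ 3)
        + t\<^sup>2 * (real n * ((?r n)\<^sup>2 * real n * sqrt (real n))) + t ^ 4 * (real n * ((?r n) ^ 4 * real n ^ 4))) \<longlonglongrightarrow> 0"
      using tendsto_add[OF tendsto_add[OF tendsto_mult_left[OF a, of "2
          * \<bar>t\<bar> ^ 3"] tendsto_mult_left[OF b, of "t\<^sup>2"]] tendsto_mult_left[OF c, of "t ^ 4"]] by simp
  qed
  from tendsto_add[OF this 1] show ?thesis by (simp add: s_def)
qed

section \<open>Asymptotic normality\<close>

text \<open>
  The total number of tableaux is the value of the counting sum at the constant function 1.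
\<close>

lemma average_symmetric_tableaux:
  fixes f :: "nat \<Rightarrow> complex"
  shows "(LINT T|measure_pmf (pmf_of_set (symmetric_tree_like_tableaux (2 * n
      + 1))). f (diagonal_boxes T)) = average n f"
proof -
  let ?S = "symmetric_tree_like_tableaux (2 * n + 1)"
  note fin = finite_symmetric_tree_like_tableaux[of "2 * n + 1"]
  note ne = symmetric_tree_like_tableaux_nonempty[of n]
  have "complex_of_nat (card ?S) = (\<Sum>T\<in>?S. (\<lambda>_. 1) (diagonal_boxes T))" by simp
  also have "\<dots> = (\<Sum>k\<le>Suc n. of_real (diagonal_count n k) * 1)" by (rule sum_symmetric_tableaux)
  also have "\<dots> = 2 ^ n * fact n" using average_1[of n, where 'a = complex]
    by (simp add: average_def field_simps)
  finally have card: "complex_of_nat (card ?S) = 2 ^ n * fact n" .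
  have "(LINT T|measure_pmf (pmf_of_set ?S). f (diagonal_boxes T))
      = (\<Sum>T\<in>?S. pmf (pmf_of_set ?S) T *\<^sub>R f (diagonal_boxes T))"
    by (rule integral_measure_pmf[OF fin]) (simp only: set_pmf_of_set[OF ne fin])
  also have "\<dots> = (\<Sum>T\<in>?S. f (diagonal_boxes T) / of_nat (card ?S))"
    by (rule sum.cong[OF refl]) (simp only: pmf_of_set[OF ne fin], simp add: scaleR_conv_of_real)
  also have "\<dots> = (\<Sum>T\<in>?S. f (diagonal_boxes T)) / of_nat (card ?S)"
    by (simp add: sum_divide_distrib)
  finally show ?thesis unfolding card sum_symmetric_tableaux average_def .
qed

theorem theorem4:
  shows "weak_conv_m
    (\<lambda>n. distr (measure_pmf (pmf_of_set (symmetric_tree_like_tableaux (2 * n + 1)))) borel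
       (\<lambda>T. (real (diagonal_boxes T) - 3 * (real n + 1) / 4) / sqrt (7 * (real n + 1) / 48)))
    std_normal_distribution"
proof (rule levy_continuity)
  let ?M = "\<lambda>n. measure_pmf (pmf_of_set (symmetric_tree_like_tableaux (2 * n + 1)))"
  let ?g = "\<lambda>n T. (real (diagonal_boxes T) - 3 * (real n + 1) / 4) / sqrt (7 * (real n + 1) / 48)"
  show "real_distribution (distr (?M n) borel (?g n))" for n
    by (intro prob_space.real_distribution_distr) (simp_all add: prob_space_measure_pmf)
  show "real_distribution std_normal_distribution" by (rule real_dist_normal_dist)
  fix t
  \<comment> \<open>For n = 0 the argument on the right divides by 0.\<close>
  have char_eq: "char (distr (?M n) borel (?g n)) t
      = scaled_char n (t / (real n * sqrt (7 * (real n + 1) / 48)))" if "n > 0" for n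
  proof -
    have "char (distr (?M n) borel (?g n)) t
        = (LINT T|?M n. (\<lambda>k. iexp (t * (deviation n k / sqrt (7 * (real n + 1) / 48)))) (diagonal_boxes T))"
      unfolding char_def deviation_def by (subst integral_distr) auto
    also have "\<dots> = average n (\<lambda>k. iexp (t * (deviation n k / sqrt (7 * (real n + 1) / 48))))"
      by (rule average_symmetric_tableaux)
    also have "\<dots> = scaled_char n (t / (real n * sqrt (7 * (real n + 1) / 48)))"
      unfolding scaled_char_def
    proof (rule average_cong)
      fix k
      have "t * (deviation n k / sqrt (7 * (real n + 1) / 48))
          = t / (real n * sqrt (7 * (real n + 1) / 48)) * (real n * deviation n k)"
        using that by simp
      then show "iexp (t * (deviation n k / sqrt (7 * (real n + 1) / 48)))
          = iexp (t / (real n * sqrt (7 * (real n + 1) / 48)) * (real n * deviation n k))"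
        by (rule arg_cong)
    qed
    finally show ?thesis .
  qed
  have "\<forall>\<^sub>F n in sequentially. scaled_char n (t / (real n * sqrt (7 * (real n + 1) / 48)))
      = char (distr (?M n) borel (?g n)) t"
    by (rule eventually_mono[OF eventually_gt_at_top[of 0]]) (rule char_eq[symmetric])
  from Lim_transform_eventually[OF scaled_char_tendsto this]
  show "(\<lambda>n. char (distr (?M n) borel (?g n)) t) \<longlonglongrightarrow> char std_normal_distribution t"
    by (simp add: char_std_normal_distribution)
qed

end
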